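(* Let $f,g,F=f+g$ and $\mathcal O$ be as in the context. Consider any $\overline x\in{\rm cl}({\rm dom}\,g)$. Let $\varepsilon>0$ be such that $\mathbb B(\overline x,\varepsilon)\subset\mathcal O$ and write $L:=\max_{x\in\mathbb B(\overline x,\varepsilon)}{\rm lip}\nabla f(x)$. Suppose that $g$ is prox-bounded with threshold $\lambda_g\in(0,\infty]$, and that $F$ has the KL property of exponent $\theta\in[\frac12,1)$ at $\overline x$. Then, for any self-adjoint linear operator $\mathcal D:\mathbb X\to\mathbb X$ with $\mathcal D\succeq\underline\eta\,\mathcal I$ for some $\underline\eta>0$ and any $\gamma\in(0,\min\{\underline\eta\lambda_g,\underline\eta/L\})$, the function $F_{\gamma,\mathcal D}$ has the KL property of exponent $\theta$ at $\overline x$.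
   Context: $\mathbb X$ is a finite-dimensional real vector space with inner product $\langle\cdot,\cdot\rangle$ and induced norm $\|\cdot\|$; $\overline{\mathbb R}=(-\infty,\infty]$; $\mathcal I$ is the identity on $\mathbb X$; $\mathbb B(x,\delta)$ is the closed ball; $\mathcal Q\succeq\mathcal Q'$ means that $\mathcal Q-\mathcal Q'$ is self-adjoint and positive semidefinite; $\|u\|_{\mathcal D}^2=\langle u,\mathcal Du\rangle$. The functions $f,g:\mathbb X\to\overline{\mathbb R}$ are proper, $F:=f+g$, and: (i) $g$ is lower semicontinuous (lsc), convex, and continuous relative to its domain; (ii) $f$ is lsc and twice continuously differentiable on an open set $\mathcal O\supset{\rm cl}({\rm dom}\,g)$; (iii) $\inf_{x\in\mathbb X}F(x)>-\infty$. ${\rm lip}\nabla f(x)$ is the Lipschitz modulus of $\nabla f$ at $x$, i.e. $\limsup_{u,v\to x,\,u\ne v}\|\nabla f(u)-\nabla f(v)\|/\|u-v\|$. The function $g$ is prox-bounded if there are $\lambda>0$ and $x\in\mathbb X$ with $\inf_z\{g(z)+\frac1{2\lambda}\|z-x\|^2\}>-\infty$; its threshold $\lambda_g$ is the supremum of all such $\lambda$. (Conventions: $\underline\eta/0=\infty$, $\underline\eta\cdot\infty=\infty$.) For $\gamma>0$ and a self-adjoint positive definite $\mathcal D$, the generalized forward-backward envelope of $F$ is $F_{\gamma,\mathcal D}(x):=\inf_{y\in\mathbb X}G_{\gamma,\mathcal D}(x,y)$, where $$G_{\gamma,\mathcal D}(x,y):=g(y)+\langle\nabla f(x),y-x\rangle+\tfrac1{2\gamma}\|y-x\|_{\mathcal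 D}^2+f(x)\ \text{ if }x\in{\rm cl}({\rm dom}\,g),\ y\in\mathbb X,$$ and $G_{\gamma,\mathcal D}(x,y):=\infty$ if $x\notin{\rm cl}({\rm dom}\,g)$. A proper function $h:\mathbb X\to\overline{\mathbb R}$ has the KL property of exponent $\theta\in[0,1)$ at $\overline x\in{\rm dom}\,\partial h$ ($\partial h$ the limiting subdifferential) if there are $\delta>0$, $\varpi\in(0,\infty]$, $c>0$ such that, with $\varphi(s)=cs^{1-\theta}$, $\varphi'(h(x)-h(\overline x))\,{\rm dist}(0,\partial h(x))\ge1$ for all $x\in\mathbb B(\overline x,\delta)$ with $h(\overline x)<h(x)<h(\overline x)+\varpi$. *)

theory Defs
  imports "HOL-Analysis.Analysis"
begin

(* Functions with values in (-\<infinity>, \<infinity>] are rendered as functions into ereal; the value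
   -\<infinity> is excluded by proper_fun, so ereal addition is unambiguous wherever it is used. *)

definition edom :: "('a \<Rightarrow> ereal) \<Rightarrow> 'a set" where
  "edom h = {x. h x < \<infinity>}"

definition proper_fun :: "('a \<Rightarrow> ereal) \<Rightarrow> bool" where
  "proper_fun h \<longleftrightarrow> (\<forall>x. h x \<noteq> -\<infinity>) \<and> edom h \<noteq> {}"

definition lsc_fun :: "('a::topological_space \<Rightarrow> ereal) \<Rightarrow> bool" where
  "lsc_fun h \<longleftrightarrow> (\<forall>x. h x \<le> Liminf (at x) h)"

definition convex_fun :: "('a::real_vector \<Rightarrow> ereal) \<Rightarrow> bool" where
  "convex_fun h \<longleftrightarrow> (\<forall>x y t. 0 < t \<and> t < 1 \<longrightarrow>
     h ((1 - t) *\<^sub>R x + t *\<^sub>R y) \<le> ereal (1 - t) * h x + ereal t * h y)"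

(* Meaningful at points around which h is finite and where it is differentiable. *)
definition grad :: "('a::real_inner \<Rightarrow> ereal) \<Rightarrow> 'a \<Rightarrow> 'a" where
  "grad h x = (THE v. GDERIV (\<lambda>y. real_of_ereal (h y)) x :> v)"

(* Intended for open S; H is the Hessian of h, continuous in the operator norm. *)
definition twice_cont_diff_on :: "('a::euclidean_space \<Rightarrow> ereal) \<Rightarrow> 'a set \<Rightarrow> bool" where
  "twice_cont_diff_on h S \<longleftrightarrow>
     (\<forall>x\<in>S. \<bar>h x\<bar> \<noteq> \<infinity>) \<and>
     (\<forall>x\<in>S. GDERIV (\<lambda>y. real_of_ereal (h y)) x :> grad h x) \<and>
     (\<exists>H :: 'a \<Rightarrow> 'a \<Rightarrow>\<^sub>L 'a.
        (\<forall>x\<in>S. (grad h has_derivative blinfun_apply (H x)) (at x)) \<and> continuous_on S H)"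

definition lip_modulus :: "('a::real_normed_vector \<Rightarrow> 'b::real_normed_vector) \<Rightarrow> 'a \<Rightarrow> ereal" where
  "lip_modulus T x =
     Limsup (at (x, x) within {(u, v). u \<noteq> v}) (\<lambda>(u, v). ereal (norm (T u - T v) / norm (u - v)))"

definition prox_parameters :: "('a::real_normed_vector \<Rightarrow> ereal) \<Rightarrow> real set" where
  "prox_parameters g =
     {l. l > 0 \<and> (\<exists>x. (INF z. g z + ereal (1 / (2 * l) * (norm (z - x))\<^sup>2)) > -\<infinity>)}"

definition prox_bounded :: "('a::real_normed_vector \<Rightarrow> ereal) \<Rightarrow> bool" where
  "prox_bounded g \<longleftrightarrow> prox_parameters g \<noteq> {}"

definition prox_threshold :: "('a::real_normed_vector \<Rightarrow> ereal) \<Rightarrow> ereal" where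
  "prox_threshold g = (SUP l\<in>prox_parameters g. ereal l)"

definition self_adjoint :: "('a::euclidean_space \<Rightarrow> 'a) \<Rightarrow> bool" where
  "self_adjoint Q \<longleftrightarrow> linear Q \<and> adjoint Q = Q"

definition psd_ge :: "('a::euclidean_space \<Rightarrow> 'a) \<Rightarrow> ('a \<Rightarrow> 'a) \<Rightarrow> bool" where
  "psd_ge Q Q' \<longleftrightarrow> self_adjoint (\<lambda>u. Q u - Q' u) \<and> (\<forall>u. 0 \<le> u \<bullet> (Q u - Q' u))"

definition fbe_model ::
  "('a::euclidean_space \<Rightarrow> ereal) \<Rightarrow> ('a \<Rightarrow> ereal) \<Rightarrow> real \<Rightarrow> ('a \<Rightarrow> 'a) \<Rightarrow> 'a \<Rightarrow> 'a \<Rightarrow> ereal" where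
  "fbe_model f g \<gamma> D x y =
     (if x \<in> closure (edom g)
      then g y + ereal (grad f x \<bullet> (y - x)) + ereal (1 / (2 * \<gamma>) * ((y - x) \<bullet> D (y - x))) + f x
      else \<infinity>)"

definition fb_envelope ::
  "('a::euclidean_space \<Rightarrow> ereal) \<Rightarrow> ('a \<Rightarrow> ereal) \<Rightarrow> real \<Rightarrow> ('a \<Rightarrow> 'a) \<Rightarrow> 'a \<Rightarrow> ereal" where
  "fb_envelope f g \<gamma> D x = (INF y. fbe_model f g \<gamma> D x y)"

definition regular_subdiff :: "('a::euclidean_space \<Rightarrow> ereal) \<Rightarrow> 'a \<Rightarrow> 'a set" where
  "regular_subdiff h x =
     {v. \<bar>h x\<bar> \<noteq> \<infinity> \<and>
         Liminf (at x) (\<lambda>y. (h y - h x - ereal (v \<bullet> (y - x))) / ereal (norm (y - x))) \<ge> 0}"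

definition limiting_subdiff :: "('a::euclidean_space \<Rightarrow> ereal) \<Rightarrow> 'a \<Rightarrow> 'a set" where
  "limiting_subdiff h x =
     {v. \<bar>h x\<bar> \<noteq> \<infinity> \<and>
         (\<exists>X V. X \<longlonglongrightarrow> x \<and> (\<lambda>n. h (X n)) \<longlonglongrightarrow> h x \<and>
                (\<forall>n. V n \<in> regular_subdiff h (X n)) \<and> V \<longlonglongrightarrow> v)}"

(* The distance from 0 to the empty set is \<infinity>; infdist would give 0. *)
definition dist_zero :: "'a::real_normed_vector set \<Rightarrow> ereal" where
  "dist_zero S = (INF v\<in>S. ereal (norm v))"

definition KL_exponent :: "('a::euclidean_space \<Rightarrow> ereal) \<Rightarrow> real \<Rightarrow> 'a \<Rightarrow> bool" where
  "KL_exponent h \<theta> xbar \<longleftrightarrow>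
     proper_fun h \<and> 0 \<le> \<theta> \<and> \<theta> < 1 \<and> limiting_subdiff h xbar \<noteq> {} \<and>
     (\<exists>\<delta>>0. \<exists>\<omega>::ereal. \<omega> > 0 \<and> (\<exists>c::real. c > 0 \<and>
        (\<forall>x\<in>cball xbar \<delta>. h xbar < h x \<and> h x < h xbar + \<omega> \<longrightarrow>
           ereal (deriv (\<lambda>s. c * s powr (1 - \<theta>)) (real_of_ereal (h x - h xbar)))
             * dist_zero (limiting_subdiff h x) \<ge> 1)))"

end

theory Submission
  imports Defs
begin

text \<open>
  Let \<open>P x\<close> be the minimizer of \<open>y \<mapsto> G(x, y)\<close>, the forward-backward step (\<open>step\<close> below). It exists
  because \<open>g\<close> is lower semicontinuous and the quadratic term beats the at most quadratic decrease of
  \<open>g\<close> that prox-boundedness allows. Convexity turns minimality into a first-order condition, and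
  that condition makes \<open>P\<close> continuous (\<open>isCont_step\<close>).

  The central estimate is \<open>\<mu> |P x - x| \<le> |v|\<close> for every regular subgradient \<open>v\<close> of the envelope at a
  point \<open>x\<close> near the base point (\<open>step_length_le_subgradient\<close>), where
  \<open>\<mu> = (\<eta>/\<gamma> - L)/2 > 0\<close>. One walks from \<open>x\<close> towards \<open>P x\<close> while keeping the candidate
  minimizer \<open>P x\<close> fixed; the envelope is bounded above by \<open>G(x + t d, P x)\<close> with \<open>d = P x - x\<close>, and
  this decreases at an initial rate of at least \<open>(\<eta>/\<gamma> - L) |d|\<^sup>2\<close>. The walk stays in the convex set \<open>cl (dom g)\<close>, so normal vectors of
  that set, which enter the subgradients at its boundary, do no harm.

  Two cases remain. If \<open>P\<close> moves the base point, then by continuity \<open>|P x - x|\<close>, and with it \<open>|v|\<close>, is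
  bounded away from zero nearby, and the KL inequality holds trivially
  (\<open>KL_exponent_off_fixed_points\<close>). If \<open>P\<close> fixes the base point, then the envelope and
  \<open>F\<close> agree there, and with \<open>y = P x\<close> and \<open>r = |y - x|\<close> three facts combine
  (\<open>KL_exponent_at_fixed_point\<close>): the envelope at \<open>x\<close> lies between \<open>F y\<close> and \<open>F y + B r\<^sup>2\<close>; the
  optimality condition gives a subgradient of \<open>F\<close> at \<open>y\<close> of norm \<open>O(r)\<close>, so the KL inequality of
  \<open>F\<close> bounds the excess of \<open>F y\<close> by \<open>O(r\<^bsup>1/\<theta>\<^esup>)\<close>; and \<open>r\<^sup>2 \<le> r\<^bsup>1/\<theta>\<^esup>\<close> for
  \<open>r \<le> 1\<close> because \<open>\<theta> \<ge> 1/2\<close>. Hence the excess of the envelope, raised to the power \<open>\<theta>\<close>, is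
  \<open>O(r)\<close> and therefore \<open>O(|v|)\<close>. The passage from regular to limiting subgradients is a limit
  argument (\<open>KL_exponentI\<close>).

  The definition of the KL property also demands a limiting subgradient of the envelope at the base
  point itself; \<open>regular_subdiff_envelope_nonempty\<close> computes one.
\<close>

section \<open>Lower semicontinuity, subgradients and the KL inequality\<close>

lemma lsc_fun_le_lim:
  assumes "lsc_fun h" "X \<longlonglongrightarrow> x" "(\<lambda>n. h (X n)) \<longlonglongrightarrow> A"
  shows "h x \<le> A"
proof (rule ccontr)
  assume "\<not> h x \<le> A"
  then obtain c where c: "A < c" "c < h x" using dense not_le by metis
  then have "c < Liminf (at x) h" using assms(1) unfolding lsc_fun_def by (metis less_le_trans)
  then have "\<forall>\<^sub>F z in at x. c < h z" by (rule less_LiminfD)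
  then have "\<forall>\<^sub>F z in nhds x. c < h z"
    using c(2) by (simp add: eventually_nhds_conv_at)
  then have "\<forall>\<^sub>F n in sequentially. c < h (X n)"
    using assms(2) by (auto simp: filterlim_iff)
  moreover have "\<forall>\<^sub>F n in sequentially. h (X n) < c"
    using assms(3) c(1) by (rule order_tendstoD)
  ultimately have "\<forall>\<^sub>F n in sequentially. False" by eventually_elim auto
  then show False by simp
qed

text \<open>The direct method: the growth bound keeps a minimizing sequence in a ball, and lower
  semicontinuity passes to the limit of a convergent subsequence.\<close>

lemma lsc_attains_min:
  fixes h :: "'a::euclidean_space \<Rightarrow> ereal" and q :: "'a \<Rightarrow> real"
  assumes lsc: "lsc_fun h" and fin: "h z0 < \<infinity>"
    and q: "continuous_on UNIV q" and c: "c > 0"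
    and growth: "\<And>z. ereal (c * (norm (z - x))\<^sup>2 - p * norm (z - x) - M) \<le> h z + ereal (q z)"
  shows "\<exists>y. \<forall>z. h y + ereal (q y) \<le> h z + ereal (q z)"
proof -
  let ?\<phi> = "\<lambda>z. h z + ereal (q z)"
  obtain u where u: "\<And>n. u n \<in> range ?\<phi>" "u \<longlonglongrightarrow> Inf (range ?\<phi>)"
    using Inf_as_limit[of "range ?\<phi>"] by auto
  from u(1) have "\<forall>n. \<exists>y. u n = ?\<phi> y" by auto
  then obtain Y where Y: "\<And>n. u n = ?\<phi> (Y n)" by metis
  have "Inf (range ?\<phi>) \<le> ?\<phi> z0" by (rule INF_lower) simp
  also have "\<dots> < \<infinity>" using fin by (cases "h z0") auto
  finally have "Inf (range ?\<phi>) < \<infinity>" .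
  then obtain B where B: "Inf (range ?\<phi>) < ereal B" using ereal_dense2 by blast
  have "\<forall>\<^sub>F n in sequentially. u n < ereal B" using u(2) B by (rule order_tendstoD)
  then obtain N where N: "\<And>n. n \<ge> N \<Longrightarrow> u n < ereal B" by (auto simp: eventually_sequentially)
  define R where "R = max 1 ((\<bar>p\<bar> + \<bar>M + B\<bar>) / c)"
  have bound: "norm (Y (n + N) - x) \<le> R" for n
  proof (cases "norm (Y (n + N) - x) \<le> 1")
    case False
    let ?r = "norm (Y (n + N) - x)"
    have "ereal (c * ?r\<^sup>2 - p * ?r - M) < ereal B"
      using growth[of "Y (n + N)"] N[of "n + N"] unfolding Y[of "n + N"]
      by (rule le_less_trans) simp
    then have "c * ?r\<^sup>2 < p * ?r + (M + B)" by simp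
    also have "p * ?r \<le> \<bar>p\<bar> * ?r" by (simp add: mult_right_mono)
    also have "M + B \<le> \<bar>M + B\<bar> * ?r" using False mult_left_mono[of 1 ?r "\<bar>M + B\<bar>"] by simp
    finally have "(c * ?r) * ?r < (\<bar>p\<bar> + \<bar>M + B\<bar>) * ?r"
      by (simp add: algebra_simps power2_eq_square)
    then have "c * ?r < \<bar>p\<bar> + \<bar>M + B\<bar>" by (rule mult_right_less_imp_less) simp
    then have "?r \<le> (\<bar>p\<bar> + \<bar>M + B\<bar>) / c" using c by (simp add: field_simps)
    then show ?thesis unfolding R_def by simp
  qed (simp add: R_def)
  have "\<forall>n. Y (n + N) \<in> cball x R"
    using bound by (simp add: dist_norm norm_minus_commute)
  then obtain y r where r: "strict_mono r" and y: "((\<lambda>n. Y (n + N)) \<circ> r) \<longlonglongrightarrow> y"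
    using compact_cball[of x R] unfolding compact_def by metis
  let ?Z = "\<lambda>n. Y (r n + N)"
  have Z: "?Z \<longlonglongrightarrow> y" using y by (simp add: o_def)
  have "(\<lambda>n. u (r n + N)) \<longlonglongrightarrow> Inf (range ?\<phi>)"
    using LIMSEQ_subseq_LIMSEQ[OF LIMSEQ_ignore_initial_segment[OF u(2), of N] r] by (simp add: o_def)
  moreover have "(\<lambda>n. ereal (q (?Z n))) \<longlonglongrightarrow> ereal (q y)"
    by (rule tendsto_ereal, rule continuous_on_tendsto_compose[OF q Z]) auto
  ultimately have "(\<lambda>n. u (r n + N) - ereal (q (?Z n))) \<longlonglongrightarrow> Inf (range ?\<phi>) - ereal (q y)"
    by (intro tendsto_diff_ereal_general) auto
  moreover have "u (r n + N) - ereal (q (?Z n)) = h (?Z n)" for n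
    unfolding Y by (cases "h (?Z n)") auto
  ultimately have "(\<lambda>n. h (?Z n)) \<longlonglongrightarrow> Inf (range ?\<phi>) - ereal (q y)" by simp
  from lsc_fun_le_lim[OF lsc Z this] have "h y \<le> Inf (range ?\<phi>) - ereal (q y)" .
  then have "?\<phi> y \<le> Inf (range ?\<phi>)"
    by (cases "h y"; cases "Inf (range ?\<phi>)") auto
  then show ?thesis by (meson INF_lower UNIV_I order_trans)
qed

text \<open>The division-free form of the difference quotient condition; it holds trivially at \<open>y\<close> with
  \<open>h y = \<infinity>\<close>, so that only real values have to be compared.\<close>

lemma regular_subdiff_iff:
  "v \<in> regular_subdiff h x \<longleftrightarrow> \<bar>h x\<bar> \<noteq> \<infinity> \<and>
     (\<forall>e>0. \<forall>\<^sub>F y in at x. h x + ereal (v \<bullet> (y - x) - e * norm (y - x)) \<le> h y)"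
proof (cases "\<bar>h x\<bar> = \<infinity>")
  case False
  then obtain s where s: "h x = ereal s" by auto
  let ?q = "\<lambda>y. (h y - h x - ereal (v \<bullet> (y - x))) / ereal (norm (y - x))"
  have quot: "ereal (- e) \<le> ?q y \<longleftrightarrow> h x + ereal (v \<bullet> (y - x) - e * norm (y - x)) \<le> h y"
    if "y \<noteq> x" for y e
    using that s by (cases "h y") (auto simp: field_simps)
  have ev_neq: "\<forall>\<^sub>F y in at x. y \<noteq> x" by (simp add: eventually_at_filter)
  have "0 \<le> Liminf (at x) ?q \<longleftrightarrow> (\<forall>e>0. \<forall>\<^sub>F y in at x. ereal (- e) \<le> ?q y)"
  proof
    assume "0 \<le> Liminf (at x) ?q"
    then show "\<forall>e>0. \<forall>\<^sub>F y in at x. ereal (- e) \<le> ?q y"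
      unfolding le_Liminf_iff
    proof (intro allI impI)
      fix e :: real assume *: "\<forall>y<0. \<forall>\<^sub>F x in at x. y < ?q x" and "e > 0"
      then have "\<forall>\<^sub>F y in at x. ereal (- e) < ?q y" by simp
      then show "\<forall>\<^sub>F y in at x. ereal (- e) \<le> ?q y" by eventually_elim (rule less_imp_le)
    qed
  next
    assume *: "\<forall>e>0. \<forall>\<^sub>F y in at x. ereal (- e) \<le> ?q y"
    show "0 \<le> Liminf (at x) ?q"
      unfolding le_Liminf_iff
    proof (intro allI impI)
      fix c :: ereal assume "c < 0"
      then obtain e where "c < ereal e" "ereal e < 0" using ereal_dense2 by blast
      then have e: "c < ereal (- (- e))" "- e > 0" by auto
      show "\<forall>\<^sub>F y in at x. c < ?q y"
        using *[rule_format, OF e(2)] by eventually_elim (use e(1) in \<open>rule less_le_trans\<close>)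
    qed
  qed
  also have "\<dots> \<longleftrightarrow> (\<forall>e>0. \<forall>\<^sub>F y in at x. h x + ereal (v \<bullet> (y - x) - e * norm (y - x)) \<le> h y)"
  proof -
    have "(\<forall>\<^sub>F y in at x. ereal (- e) \<le> ?q y) \<longleftrightarrow>
        (\<forall>\<^sub>F y in at x. h x + ereal (v \<bullet> (y - x) - e * norm (y - x)) \<le> h y)" for e
      by (rule eventually_cong[OF ev_neq]) (rule quot)
    then show ?thesis by blast
  qed
  finally show ?thesis using False by (simp add: regular_subdiff_def)
qed (simp add: regular_subdiff_def)

lemma regular_subset_limiting: "regular_subdiff h x \<subseteq> limiting_subdiff h x"
proof
  fix v assume v: "v \<in> regular_subdiff h x"
  then have "\<bar>h x\<bar> \<noteq> \<infinity>" by (simp add: regular_subdiff_def)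
  with v show "v \<in> limiting_subdiff h x"
    unfolding limiting_subdiff_def
    by (intro CollectI conjI exI[of _ "\<lambda>_. x"] exI[of _ "\<lambda>_. v"]) auto
qed

lemma deriv_desingularizer:
  assumes "s > (0::real)"
  shows "deriv (\<lambda>s. c * s powr (1 - \<theta>)) s = c * (1 - \<theta>) * s powr (- \<theta>)"
  by (rule DERIV_imp_deriv) (use assms in \<open>auto intro!: derivative_eq_intros\<close>)

text \<open>Multiplying out \<open>\<phi>'(s) = c (1 - \<theta>) s\<^bsup>-\<theta>\<^esup>\<close> turns the KL inequality into a real inequality for
  individual subgradients.\<close>

lemma KL_exponentD:
  assumes "KL_exponent h \<theta> x0"
  obtains \<delta> K :: real and \<omega> :: ereal where "\<delta> > 0" "\<omega> > 0" "K > 0"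
    "\<And>x v. x \<in> cball x0 \<delta> \<Longrightarrow> v \<in> limiting_subdiff h x \<Longrightarrow> h x0 < h x \<Longrightarrow> h x < h x0 + \<omega> \<Longrightarrow>
       real_of_ereal (h x - h x0) powr \<theta> \<le> K * norm v"
proof -
  obtain \<delta> \<omega> c where *: "\<delta> > 0" "\<omega> > (0::ereal)" "c > (0::real)"
    and KL: "\<forall>x\<in>cball x0 \<delta>. h x0 < h x \<and> h x < h x0 + \<omega> \<longrightarrow>
       ereal (deriv (\<lambda>s. c * s powr (1 - \<theta>)) (real_of_ereal (h x - h x0)))
         * dist_zero (limiting_subdiff h x) \<ge> 1"
    and \<theta>: "\<theta> < 1" and ne: "limiting_subdiff h x0 \<noteq> {}"
    using assms unfolding KL_exponent_def by (elim conjE exE) (rule that)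
  have fin: "\<bar>h x0\<bar> \<noteq> \<infinity>" using ne by (auto simp: limiting_subdiff_def)
  show thesis
  proof (rule that[of \<delta> \<omega> "c * (1 - \<theta>)"])
    fix x v assume x: "x \<in> cball x0 \<delta>" "v \<in> limiting_subdiff h x" "h x0 < h x" "h x < h x0 + \<omega>"
    define s where "s = real_of_ereal (h x - h x0)"
    have s: "s > 0" unfolding s_def using fin x by (cases "h x"; cases "h x0") auto
    have "dist_zero (limiting_subdiff h x) \<le> ereal (norm v)"
      unfolding dist_zero_def using x(2) by (rule INF_lower)
    then have "ereal (c * (1 - \<theta>) * s powr (- \<theta>)) * dist_zero (limiting_subdiff h x)
        \<le> ereal (c * (1 - \<theta>) * s powr (- \<theta>)) * ereal (norm v)"
      using *(3) \<theta> by (intro ereal_mult_left_mono) auto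
    with KL[rule_format, OF x(1) conjI, OF x(3,4)] have "ereal 1 \<le> ereal (c * (1 - \<theta>) * s powr (- \<theta>)) * ereal (norm v)"
      unfolding s_def[symmetric] deriv_desingularizer[OF s] one_ereal_def by (rule order_trans)
    then have "s powr \<theta> * 1 \<le> s powr \<theta> * (c * (1 - \<theta>) * s powr (- \<theta>) * norm v)"
      by (intro mult_left_mono) simp_all
    also have "\<dots> = (s powr \<theta> * s powr (- \<theta>)) * (c * (1 - \<theta>) * norm v)"
      by (simp only: mult_ac)
    also have "s powr \<theta> * s powr (- \<theta>) = 1"
      using s by (simp add: powr_add[symmetric])
    finally show "real_of_ereal (h x - h x0) powr \<theta> \<le> c * (1 - \<theta>) * norm v"
      unfolding s_def[symmetric] by simp
  qed (use *(1-3) \<theta> in simp_all)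
qed

text \<open>Regular subgradients suffice: a limiting subgradient at \<open>x\<close> is a limit of regular ones at
  points \<open>X n\<close> with \<open>h (X n) \<longlonglongrightarrow> h x\<close>, so the strict value constraints hold eventually along the
  sequence, and both sides of the estimate converge. The radius is halved so that the closed ball of
  the definition lies in the open ball in which the estimate is known.\<close>

lemma KL_exponentI:
  fixes h :: "'a::euclidean_space \<Rightarrow> ereal"
  assumes proper: "proper_fun h" and \<theta>: "0 \<le> \<theta>" "\<theta> < 1"
    and ne: "limiting_subdiff h x0 \<noteq> {}" and pos: "\<delta> > 0" "\<omega> > 0" "K > 0"
    and est: "\<And>x v. x \<in> ball x0 \<delta> \<Longrightarrow> v \<in> regular_subdiff h x \<Longrightarrow> h x0 < h x \<Longrightarrow> h x < h x0 + \<omega> \<Longrightarrow>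
       real_of_ereal (h x - h x0) powr \<theta> \<le> K * norm v"
  shows "KL_exponent h \<theta> x0"
proof -
  define c where "c = K / (1 - \<theta>)"
  have c: "c > 0" "c * (1 - \<theta>) = K" using pos(3) \<theta>(2) unfolding c_def by simp_all
  have fin: "\<bar>h x0\<bar> \<noteq> \<infinity>" using ne by (auto simp: limiting_subdiff_def)
  have lim: "real_of_ereal (h x - h x0) powr \<theta> \<le> K * norm v"
    if x: "x \<in> ball x0 \<delta>" "v \<in> limiting_subdiff h x" "h x0 < h x" "h x < h x0 + \<omega>" for x v
  proof -
    obtain X V where XV: "X \<longlonglongrightarrow> x" "(\<lambda>n. h (X n)) \<longlonglongrightarrow> h x"
      "\<forall>n. V n \<in> regular_subdiff h (X n)" "V \<longlonglongrightarrow> v" and fx: "\<bar>h x\<bar> \<noteq> \<infinity>"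
      using x(2) unfolding limiting_subdiff_def by (elim CollectE conjE exE) (rule that)
    have real: "h x - h x0 = ereal (real_of_ereal (h x - h x0))"
      using fin fx by (cases "h x"; cases "h x0") auto
    have "(\<lambda>n. h (X n) - h x0) \<longlonglongrightarrow> h x - h x0"
      using fin by (intro tendsto_diff_ereal_general XV) auto
    then have "(\<lambda>n. real_of_ereal (h (X n) - h x0)) \<longlonglongrightarrow> real_of_ereal (h x - h x0)"
      by (intro lim_real_of_ereal) (simp only: real[symmetric])
    moreover have "real_of_ereal (h x - h x0) \<noteq> 0"
      using fin fx x(3) by (cases "h x"; cases "h x0") auto
    ultimately have l1: "(\<lambda>n. real_of_ereal (h (X n) - h x0) powr \<theta>) \<longlonglongrightarrow> real_of_ereal (h x - h x0) powr \<theta>"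
      by (intro tendsto_powr) auto
    have l2: "(\<lambda>n. K * norm (V n)) \<longlonglongrightarrow> K * norm v"
      by (intro tendsto_intros XV)
    have "\<forall>\<^sub>F n in sequentially. X n \<in> ball x0 \<delta>"
      using x(1) by (intro topological_tendstoD[OF XV(1)]) auto
    moreover have "\<forall>\<^sub>F n in sequentially. h x0 < h (X n)" "\<forall>\<^sub>F n in sequentially. h (X n) < h x0 + \<omega>"
      using order_tendstoD[OF XV(2)] x by auto
    ultimately have "\<forall>\<^sub>F n in sequentially. real_of_ereal (h (X n) - h x0) powr \<theta> \<le> K * norm (V n)"
      by eventually_elim (rule est[OF _ XV(3)[rule_format]])
    with l1 l2 show ?thesis by (intro tendsto_le[OF _ l2 l1]) auto
  qed
  have main: "\<forall>x\<in>cball x0 (\<delta> / 2). h x0 < h x \<and> h x < h x0 + \<omega> \<longrightarrow>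
      ereal (deriv (\<lambda>s. c * s powr (1 - \<theta>)) (real_of_ereal (h x - h x0)))
        * dist_zero (limiting_subdiff h x) \<ge> 1"
  proof (intro ballI impI, elim conjE)
    fix x assume x: "x \<in> cball x0 (\<delta> / 2)" "h x0 < h x" "h x < h x0 + \<omega>"
    define s where "s = real_of_ereal (h x - h x0)"
    have s: "s > 0" unfolding s_def using fin x by (cases "h x"; cases "h x0") auto
    have "ereal (s powr \<theta> / K) \<le> dist_zero (limiting_subdiff h x)"
      unfolding dist_zero_def
    proof (rule INF_greatest)
      fix v assume "v \<in> limiting_subdiff h x"
      then have "s powr \<theta> \<le> K * norm v"
        unfolding s_def using x pos by (intro lim) auto
      then show "ereal (s powr \<theta> / K) \<le> ereal (norm v)" using pos by (simp add: field_simps)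
    qed
    then have "ereal (K * s powr (- \<theta>)) * ereal (s powr \<theta> / K)
        \<le> ereal (K * s powr (- \<theta>)) * dist_zero (limiting_subdiff h x)"
      using pos by (intro ereal_mult_left_mono) auto
    moreover have "ereal (K * s powr (- \<theta>)) * ereal (s powr \<theta> / K) = 1"
    proof -
      have "s powr (- \<theta>) * s powr \<theta> = 1" using s by (simp add: powr_add[symmetric])
      then show ?thesis using pos by (simp add: one_ereal_def)
    qed
    ultimately show "ereal (deriv (\<lambda>s. c * s powr (1 - \<theta>)) (real_of_ereal (h x - h x0)))
        * dist_zero (limiting_subdiff h x) \<ge> 1"
      unfolding s_def[symmetric] deriv_desingularizer[OF s] c(2) by (rule ord_eq_le_trans[OF sym, rotated])
  qed
  show ?thesis
    unfolding KL_exponent_def using proper \<theta> ne pos(1,2) c(1) main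
    by (intro conjI exI[of _ "\<delta> / 2"] exI[of _ \<omega>] exI[of _ c]) (assumption | rule half_gt_zero)+
qed

section \<open>The Lipschitz modulus and the descent lemma\<close>

text \<open>The pairs \<open>(x + t u, x)\<close> for \<open>t > 0\<close> tending to 0 take part in the upper limit that defines the modulus, and
  along them the quotient tends to \<open>|T' u| / |u|\<close>.\<close>

lemma norm_derivative_le_lip_modulus:
  fixes T :: "'a::real_normed_vector \<Rightarrow> 'b::real_normed_vector"
  assumes "(T has_derivative T') (at x)" and u: "u \<noteq> 0"
  shows "ereal (norm (T' u) / norm u) \<le> lip_modulus T x"
proof (rule dense_ge)
  fix c assume c: "lip_modulus T x < c"
  let ?p = "\<lambda>t::real. (x + t *\<^sub>R u, x)"
  have lin: "linear T'" using assms(1) by (auto dest: has_derivative_linear)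
  have pl0: "((\<lambda>t. x + t *\<^sub>R u) \<longlongrightarrow> x + 0 *\<^sub>R u) (at_right 0)" by (intro tendsto_intros)
  then have "(?p \<longlongrightarrow> (x + 0 *\<^sub>R u, x)) (at_right 0)" by (intro tendsto_intros)
  moreover have "\<forall>\<^sub>F t in at_right (0::real). ?p t \<in> {(u, v). u \<noteq> v} - {(x, x)}"
    using u by (auto simp: eventually_at_right_field intro!: exI[of _ 1])
  ultimately have pl: "filterlim ?p (at (x, x) within {(u, v). u \<noteq> v}) (at_right 0)"
    by (auto simp: filterlim_at elim!: eventually_mono)
  have "\<forall>\<^sub>F z in at (x, x) within {(u, v). u \<noteq> v}. (case z of (u, v) \<Rightarrow> ereal (norm (T u - T v) / norm (u - v))) < c"
    using c unfolding lip_modulus_def by (rule Limsup_lessD)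
  then have "\<forall>\<^sub>F t in at_right 0. (case ?p t of (u, v) \<Rightarrow> ereal (norm (T u - T v) / norm (u - v))) < c"
    using pl by (auto simp: filterlim_iff)
  moreover have "((\<lambda>t. norm (T (x + t *\<^sub>R u) - T x - T' (x + t *\<^sub>R u - x)) / norm (x + t *\<^sub>R u - x)) \<longlongrightarrow> 0) (at_right 0)"
  proof -
    have "filterlim (\<lambda>t. x + t *\<^sub>R u) (at x) (at_right 0)"
      using pl0 u by (auto simp: filterlim_at eventually_at_right_field intro!: exI[of _ 1])
    then show ?thesis
      using assms(1) unfolding has_derivative_iff_norm by (elim conjE) (rule filterlim_compose)
  qed
  ultimately have "\<forall>\<^sub>F t in at_right 0. ereal (norm (T' u) / norm u
      - norm (T (x + t *\<^sub>R u) - T x - T' (x + t *\<^sub>R u - x)) / norm (x + t *\<^sub>R u - x)) \<le> c"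
    and r: "((\<lambda>t. ereal (norm (T' u) / norm u
      - norm (T (x + t *\<^sub>R u) - T x - T' (x + t *\<^sub>R u - x)) / norm (x + t *\<^sub>R u - x)))
      \<longlongrightarrow> ereal (norm (T' u) / norm u - 0)) (at_right 0)"
  proof -
    assume *: "\<forall>\<^sub>F t in at_right 0. (case ?p t of (u, v) \<Rightarrow> ereal (norm (T u - T v) / norm (u - v))) < c"
    show "\<forall>\<^sub>F t in at_right 0. ereal (norm (T' u) / norm u
      - norm (T (x + t *\<^sub>R u) - T x - T' (x + t *\<^sub>R u - x)) / norm (x + t *\<^sub>R u - x)) \<le> c"
      using * eventually_at_right_less[of "0::real"]
    proof eventually_elim
      case (elim t)
      let ?w = "T (x + t *\<^sub>R u) - T x"
      have "norm (t *\<^sub>R T' u) \<le> norm ?w + norm (?w - t *\<^sub>R T' u)"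
        by (metis norm_minus_commute norm_triangle_sub)
      then have "norm (T' u) / norm u - norm (?w - t *\<^sub>R T' u) / (t * norm u) \<le> norm ?w / (t * norm u)"
        using elim(2) u divide_right_mono[of "norm (t *\<^sub>R T' u)" "norm ?w + norm (?w - t *\<^sub>R T' u)" "t * norm u"]
        by (simp add: add_divide_distrib)
      moreover have "ereal (norm ?w / (t * norm u)) \<le> c"
        using elim by simp
      ultimately have "ereal (norm (T' u) / norm u - norm (?w - t *\<^sub>R T' u) / (t * norm u)) \<le> c"
        by (meson ereal_less_eq(3) order_trans)
      then show ?case
        using elim(2) by (simp add: linear_cmul[OF lin])
    qed
  qed (intro tendsto_intros; assumption)
  then show "ereal (norm (T' u) / norm u) \<le> c" using tendsto_upperbound[OF r] by simp
qed

text \<open>Along the segment from \<open>x\<close> to \<open>y\<close>, the difference of the two sides has nonpositive derivative by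
  the Lipschitz bound.\<close>

lemma descent_lemma:
  fixes \<phi> :: "'a::real_inner \<Rightarrow> real"
  assumes C: "convex C" "x \<in> C" "y \<in> C"
    and grad: "\<And>z. z \<in> C \<Longrightarrow> GDERIV \<phi> z :> G z"
    and lip: "\<And>z w. z \<in> C \<Longrightarrow> w \<in> C \<Longrightarrow> norm (G z - G w) \<le> l * norm (z - w)"
  shows "\<phi> y \<le> \<phi> x + G x \<bullet> (y - x) + l / 2 * (norm (y - x))\<^sup>2"
proof -
  define d where "d = y - x"
  let ?\<psi> = "\<lambda>t. \<phi> (x + t *\<^sub>R d) - t * (G x \<bullet> d) - l / 2 * t\<^sup>2 * (norm d)\<^sup>2"
  have "?\<psi> 1 \<le> ?\<psi> 0"
  proof (rule DERIV_nonpos_imp_nonincreasing[of 0 1 ?\<psi>])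
    fix t :: real assume t: "0 \<le> t" "t \<le> 1"
    have z: "x + t *\<^sub>R d \<in> C"
      using convexD_alt[OF C t] by (simp add: d_def algebra_simps)
    have "((\<lambda>t. x + t *\<^sub>R d) has_derivative (\<lambda>s. s *\<^sub>R d)) (at t)"
      by (auto intro!: derivative_eq_intros)
    moreover have "(\<phi> has_derivative (\<lambda>h. h \<bullet> G (x + t *\<^sub>R d))) (at (x + t *\<^sub>R d))"
      using grad[OF z] by (simp add: gderiv_def)
    ultimately have "((\<lambda>t. \<phi> (x + t *\<^sub>R d)) has_derivative (\<lambda>s. (s *\<^sub>R d) \<bullet> G (x + t *\<^sub>R d))) (at t)"
      by (rule has_derivative_compose)
    then have D: "((\<lambda>t. \<phi> (x + t *\<^sub>R d)) has_real_derivative d \<bullet> G (x + t *\<^sub>R d)) (at t)"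
      by (simp add: has_field_derivative_def mult_commute_abs)
    have "(?\<psi> has_real_derivative d \<bullet> G (x + t *\<^sub>R d) - G x \<bullet> d - l * t * (norm d)\<^sup>2) (at t)"
      by (auto intro!: derivative_eq_intros D)
    moreover have "d \<bullet> G (x + t *\<^sub>R d) - G x \<bullet> d - l * t * (norm d)\<^sup>2 \<le> 0"
    proof -
      have "d \<bullet> (G (x + t *\<^sub>R d) - G x) \<le> norm d * norm (G (x + t *\<^sub>R d) - G x)"
        by (rule norm_cauchy_schwarz)
      also have "\<dots> \<le> norm d * (l * norm (t *\<^sub>R d))"
        using lip[OF z C(2)] by (intro mult_left_mono) auto
      finally show ?thesis using t
        by (simp add: inner_diff_right inner_commute power2_eq_square mult_ac)
    qed
    ultimately show "\<exists>y. (?\<psi> has_real_derivative y) (at t) \<and> y \<le> 0" by blast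
  qed simp
  then show ?thesis by (simp add: d_def)
qed

section \<open>The forward-backward step and the envelope\<close>

text \<open>The parameter condition \<open>prox\<close> is what \<open>\<gamma> < \<eta> \<lambda>\<^sub>g\<close> says once the threshold is unfolded as a
  supremum.\<close>

locale forward_backward =
  fixes f g :: "'a::euclidean_space \<Rightarrow> ereal" and S :: "'a set" and D :: "'a \<Rightarrow> 'a" and \<eta> \<gamma> :: real
  assumes proper_g: "proper_fun g" and lsc_g: "lsc_fun g" and convex_g: "convex_fun g"
    and open_S: "open S" and dom_S: "closure (edom g) \<subseteq> S" and C2_f: "twice_cont_diff_on f S"
    and self_adjoint_D: "self_adjoint D" and psd_D: "psd_ge D (\<lambda>u. \<eta> *\<^sub>R u)"
    and eta_pos: "\<eta> > 0" and gamma_pos: "\<gamma> > 0"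
    and prox: "\<exists>l\<in>prox_parameters g. \<gamma> / \<eta> < l"
begin

abbreviation "fr x \<equiv> real_of_ereal (f x)"
abbreviation "gr x \<equiv> real_of_ereal (g x)"

text \<open>\<open>G(x, y)\<close> without \<open>g y\<close> and \<open>f x\<close>. The forward-backward step minimizes \<open>g\<close> plus this
  function, also for \<open>x\<close> outside \<open>cl (dom g)\<close>; only the envelope is restricted to that set.\<close>

definition smooth_model :: "'a \<Rightarrow> 'a \<Rightarrow> real" where
  "smooth_model x y = grad f x \<bullet> (y - x) + 1 / (2 * \<gamma>) * ((y - x) \<bullet> D (y - x))"

definition step :: "'a \<Rightarrow> 'a" where
  "step x = (SOME y. \<forall>z. g y + ereal (smooth_model x y) \<le> g z + ereal (smooth_model x z))"

text \<open>The value of the envelope as a real number, meaningful on \<open>cl (dom g)\<close>.\<close>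

definition env :: "'a \<Rightarrow> real" where
  "env x = gr (step x) + smooth_model x (step x) + fr x"

lemma linear_D: "linear D"
  using self_adjoint_D by (simp add: self_adjoint_def)

lemma bounded_linear_D: "bounded_linear D"
  using linear_D by (simp add: linear_conv_bounded_linear)

lemmas D_simps = linear_add[OF linear_D] linear_diff[OF linear_D] linear_cmul[OF linear_D]
  linear_neg[OF linear_D]

lemma D_sym: "D u \<bullet> v = u \<bullet> D v"
  using self_adjoint_D adjoint_works[OF linear_D, of u v] by (simp add: self_adjoint_def)

lemma D_coercive: "\<eta> * (norm u)\<^sup>2 \<le> u \<bullet> D u"
  using psd_D by (simp add: psd_ge_def inner_diff_right power2_norm_eq_inner)

lemma f_finite: "x \<in> S \<Longrightarrow> f x = ereal (fr x)"
  using C2_f by (auto simp: twice_cont_diff_on_def ereal_real)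

lemma f_gderiv: "x \<in> S \<Longrightarrow> GDERIV (\<lambda>y. real_of_ereal (f y)) x :> grad f x"
  using C2_f by (auto simp: twice_cont_diff_on_def)

lemma grad_f_differentiable:
  assumes "x \<in> S" obtains H where "(grad f has_derivative H) (at x)"
  using C2_f assms by (auto simp: twice_cont_diff_on_def)

lemma isCont_grad_f: "x \<in> S \<Longrightarrow> isCont (grad f) x"
  by (metis grad_f_differentiable has_derivative_continuous)

lemma g_not_MInf: "g x \<noteq> -\<infinity>"
  using proper_g by (simp add: proper_fun_def)

lemma g_finite: "x \<in> edom g \<Longrightarrow> g x = ereal (gr x)"
  using g_not_MInf[of x] by (cases "g x") (auto simp: edom_def)

lemma g_realE: assumes "x \<in> edom g" obtains r where "g x = ereal r"
  using g_finite[OF assms] by blast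

lemma dom_ne: "edom g \<noteq> {}"
  using proper_g by (simp add: proper_fun_def)

lemma convex_dom: "convex (edom g)"
  unfolding convex_alt
proof (intro ballI allI impI)
  fix x y and t :: real assume xy: "x \<in> edom g" "y \<in> edom g" and "0 \<le> t \<and> t \<le> 1"
  then consider "t = 0" | "t = 1" | "0 < t \<and> t < 1" by fastforce
  then show "(1 - t) *\<^sub>R x + t *\<^sub>R y \<in> edom g"
  proof cases
    case 3
    then have "g ((1 - t) *\<^sub>R x + t *\<^sub>R y) \<le> ereal (1 - t) * g x + ereal t * g y"
      using convex_g by (auto simp: convex_fun_def)
    also have "\<dots> < \<infinity>"
      using xy by (auto elim!: g_realE)
    finally show ?thesis by (simp add: edom_def)
  qed (use xy in auto)
qed

lemma smooth_model_lower: "- norm (grad f x) * norm (y - x) + \<eta> / (2 * \<gamma>) * (norm (y - x))\<^sup>2 \<le> smooth_model x y"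
proof -
  have "- (norm (grad f x) * norm (y - x)) \<le> grad f x \<bullet> (y - x)"
    using Cauchy_Schwarz_ineq2[of "grad f x" "y - x"] by linarith
  moreover have "1 / (2 * \<gamma>) * (\<eta> * (norm (y - x))\<^sup>2) \<le> 1 / (2 * \<gamma>) * ((y - x) \<bullet> D (y - x))"
    using gamma_pos by (intro mult_left_mono D_coercive) auto
  ultimately show ?thesis by (simp add: smooth_model_def)
qed

text \<open>A proximal parameter \<open>l > \<gamma>/\<eta>\<close> bounds \<open>g\<close> below by \<open>- |z - x0|\<^sup>2 / (2 l)\<close> up to a constant.
  The quadratic term contributes at least \<open>\<eta> |z - x|\<^sup>2 / (2 \<gamma>)\<close>, which has the larger coefficient;
  the change of centre costs only lower-order terms.\<close>

lemma model_growth: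
  "\<exists>c>0. \<exists>p M. \<forall>z. ereal (c * (norm (z - x))\<^sup>2 - p * norm (z - x) - M) \<le> g z + ereal (smooth_model x z)"
proof -
  obtain l x0 where l: "l > \<gamma> / \<eta>" "l > 0"
    and inf: "(INF z. g z + ereal (1 / (2 * l) * (norm (z - x0))\<^sup>2)) > -\<infinity>"
    using prox by (auto simp: prox_parameters_def)
  obtain m where m: "ereal m < (INF z. g z + ereal (1 / (2 * l) * (norm (z - x0))\<^sup>2))"
    using ereal_dense2[OF inf] by blast
  define b where "b = norm (x - x0)"
  define c where "c = \<eta> / (2 * \<gamma>) - 1 / (2 * l)"
  define p where "p = norm (grad f x) + b / l"
  define M where "M = b\<^sup>2 / (2 * l) - m"
  have "c > 0" unfolding c_def using l eta_pos gamma_pos by (simp add: field_simps)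
  moreover have "ereal (c * (norm (z - x))\<^sup>2 - p * norm (z - x) - M) \<le> g z + ereal (smooth_model x z)" for z
  proof (cases "g z")
    case (real s)
    let ?R = "norm (z - x)"
    have "ereal m \<le> g z + ereal (1 / (2 * l) * (norm (z - x0))\<^sup>2)"
      using m by (meson INF_lower UNIV_I less_imp_le order_trans)
    then have "m \<le> s + 1 / (2 * l) * (norm (z - x0))\<^sup>2" by (simp add: real)
    moreover have "norm (z - x0) \<le> ?R + b"
      unfolding b_def using norm_triangle_ineq[of "z - x" "x - x0"] by simp
    then have "1 / (2 * l) * (norm (z - x0))\<^sup>2 \<le> 1 / (2 * l) * (?R + b)\<^sup>2"
      using l by (intro mult_left_mono power_mono) auto
    moreover have "1 / (2 * l) * (?R + b)\<^sup>2 = ?R\<^sup>2 / (2 * l) + b / l * ?R + b\<^sup>2 / (2 * l)"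
      using l by (simp add: field_simps power2_eq_square)
    ultimately have "c * ?R\<^sup>2 - p * ?R - M \<le> s + smooth_model x z"
      using smooth_model_lower[of x z] unfolding c_def p_def M_def by (simp add: algebra_simps)
    then show ?thesis by (simp add: real)
  qed (use g_not_MInf in auto)
  ultimately show ?thesis by blast
qed

lemma continuous_on_smooth_model: "continuous_on UNIV (smooth_model x)"
  unfolding smooth_model_def[abs_def]
  by (intro continuous_intros bounded_linear.continuous_on[OF bounded_linear_D])

lemma step_minimal: "g (step x) + ereal (smooth_model x (step x)) \<le> g z + ereal (smooth_model x z)"
proof -
  obtain c p M where cpM: "c > 0"
    "\<And>z. ereal (c * (norm (z - x))\<^sup>2 - p * norm (z - x) - M) \<le> g z + ereal (smooth_model x z)"
    using model_growth[of x] by metis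
  obtain z0 where "g z0 < \<infinity>" using dom_ne by (auto simp: edom_def)
  from lsc_attains_min[OF lsc_g this continuous_on_smooth_model cpM]
  show ?thesis unfolding step_def by (rule someI2_ex) blast
qed

lemma step_dom: "step x \<in> edom g"
proof -
  obtain z where "z \<in> edom g" using dom_ne by auto
  then have "g z + ereal (smooth_model x z) < \<infinity>" by (auto elim!: g_realE)
  then have "g (step x) + ereal (smooth_model x (step x)) < \<infinity>"
    using step_minimal[of x z] by (rule le_less_trans[rotated])
  then show ?thesis by (simp add: edom_def)
qed

lemma env_le: "z \<in> edom g \<Longrightarrow> env x \<le> gr z + smooth_model x z + fr x"
  using step_minimal[of x z] step_dom[of x] by (auto simp: env_def elim!: g_realE)

lemma envelope_eq_env:
  assumes "x \<in> closure (edom g)"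
  shows "fb_envelope f g \<gamma> D x = ereal (env x)"
proof -
  have fx: "f x = ereal (fr x)" using assms dom_S f_finite by blast
  have model: "fbe_model f g \<gamma> D x y = g y + ereal (smooth_model x y) + ereal (fr x)" for y
    unfolding fbe_model_def smooth_model_def using assms g_not_MInf[of y]
    by (subst fx) (cases "g y"; simp)
  have "(INF y. fbe_model f g \<gamma> D x y) = g (step x) + ereal (smooth_model x (step x)) + ereal (fr x)"
  proof (rule antisym)
    show "(INF y. fbe_model f g \<gamma> D x y) \<le> g (step x) + ereal (smooth_model x (step x)) + ereal (fr x)"
      unfolding model by (rule INF_lower) simp
    show "g (step x) + ereal (smooth_model x (step x)) + ereal (fr x) \<le> (INF y. fbe_model f g \<gamma> D x y)"
      unfolding model by (intro INF_greatest add_right_mono step_minimal)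
  qed
  also have "\<dots> = ereal (env x)"
    using step_dom[of x] by (auto simp: env_def elim!: g_realE)
  finally show ?thesis by (simp add: fb_envelope_def)
qed

lemma envelope_outside: "x \<notin> closure (edom g) \<Longrightarrow> fb_envelope f g \<gamma> D x = \<infinity>"
  by (simp add: fb_envelope_def fbe_model_def)

lemma proper_envelope: "proper_fun (fb_envelope f g \<gamma> D)"
proof -
  obtain z where "z \<in> edom g" using dom_ne by auto
  then have "z \<in> edom (fb_envelope f g \<gamma> D)"
    using closure_subset by (force simp: edom_def envelope_eq_env)
  moreover have "fb_envelope f g \<gamma> D x \<noteq> -\<infinity>" for x
    by (cases "x \<in> closure (edom g)") (auto simp: envelope_eq_env envelope_outside)
  ultimately show ?thesis by (auto simp: proper_fun_def)
qed

lemma smooth_model_step_segment: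
  "smooth_model x (y + t *\<^sub>R (z - y)) = smooth_model x y + t * ((grad f x + (1 / \<gamma>) *\<^sub>R D (y - x)) \<bullet> (z - y))
     + t\<^sup>2 * (1 / (2 * \<gamma>) * ((z - y) \<bullet> D (z - y)))"
proof -
  define u d where "u = y - x" and "d = z - y"
  have "d \<bullet> D u = D u \<bullet> d" "u \<bullet> D d = D u \<bullet> d"
    by (rule inner_commute, rule D_sym[symmetric])
  then have "(u + t *\<^sub>R d) \<bullet> D (u + t *\<^sub>R d) = u \<bullet> D u + 2 * t * (D u \<bullet> d) + t\<^sup>2 * (d \<bullet> D d)"
    by (simp add: D_simps inner_add_left inner_add_right power2_eq_square algebra_simps)
  moreover have "y + t *\<^sub>R d - x = u + t *\<^sub>R d" by (simp add: u_def)
  moreover have "1 / (2 * \<gamma>) * (A + 2 * t * B + C) = 1 / (2 * \<gamma>) * A + t * (1 / \<gamma> * B) + 1 / (2 * \<gamma>) * C" for A B C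
    using gamma_pos by (simp add: field_simps)
  ultimately show ?thesis
    unfolding smooth_model_def u_def[symmetric] d_def[symmetric] by (simp add: inner_add_left inner_add_right algebra_simps)
qed

text \<open>The first-order condition \<open>- grad f(x) - D (P x - x) / \<gamma> \<in> \<partial>g(P x)\<close>, in the form of the convex subgradient
  inequality: compare \<open>P x\<close> with points on the segment to \<open>z\<close>, divide by \<open>t\<close> and let \<open>t\<close> tend to zero.\<close>

lemma step_optimality:
  assumes z: "z \<in> edom g"
  shows "gr (step x) - gr z \<le> (grad f x + (1 / \<gamma>) *\<^sub>R D (step x - x)) \<bullet> (z - step x)"
proof -
  let ?y = "step x"
  let ?s = "(grad f x + (1 / \<gamma>) *\<^sub>R D (?y - x)) \<bullet> (z - ?y)"
  let ?k = "1 / (2 * \<gamma>) * ((z - ?y) \<bullet> D (z - ?y))"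
  have "gr ?y - gr z \<le> ?s + t * ?k" if t: "0 < t" "t < 1" for t
  proof -
    let ?w = "?y + t *\<^sub>R (z - ?y)"
    have w: "?w = (1 - t) *\<^sub>R ?y + t *\<^sub>R z" by (simp add: algebra_simps)
    have dom_w: "?w \<in> edom g"
      unfolding w using convex_dom step_dom[of x] z t by (simp add: convex_alt)
    have "g ?w \<le> ereal (1 - t) * g ?y + ereal t * g z"
      unfolding w using convex_g t by (auto simp: convex_fun_def)
    then have "gr ?w \<le> (1 - t) * gr ?y + t * gr z"
      using dom_w z step_dom[of x] by (auto elim!: g_realE)
    moreover have "gr ?y + smooth_model x ?y \<le> gr ?w + smooth_model x ?w"
      using env_le[OF dom_w, of x] by (simp add: env_def)
    ultimately have "t * (gr ?y - gr z) \<le> t * (?s + t * ?k)"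
      unfolding smooth_model_step_segment by (simp add: algebra_simps power2_eq_square)
    then show ?thesis using t(1) by (rule mult_left_le_imp_le)
  qed
  then have ev: "\<forall>\<^sub>F t in at_right 0. gr ?y - gr z \<le> ?s + t * ?k"
    by (auto simp: eventually_at_right_field intro!: exI[of _ 1])
  have "((\<lambda>t. ?s + t * ?k) \<longlongrightarrow> ?s + 0 * ?k) (at_right 0)"
    by (intro tendsto_intros)
  from tendsto_lowerbound[OF this ev] show ?thesis by simp
qed

text \<open>Adding the first-order conditions of the two steps removes \<open>g\<close> (monotonicity of its
  subdifferential); coercivity of \<open>D\<close> does the rest.\<close>

lemma norm_step_diff_le:
  "norm (step x - step x') \<le> \<gamma> / \<eta> * norm (grad f x' - grad f x + (1 / \<gamma>) *\<^sub>R D (x - x'))"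
proof -
  let ?y = "step x" and ?y' = "step x'"
  let ?r = "grad f x' - grad f x + (1 / \<gamma>) *\<^sub>R D (x - x')"
  have "0 \<le> (grad f x + (1 / \<gamma>) *\<^sub>R D (?y - x)) \<bullet> (?y' - ?y)
      + (grad f x' + (1 / \<gamma>) *\<^sub>R D (?y' - x')) \<bullet> (?y - ?y')"
    using step_optimality[OF step_dom, of x x'] step_optimality[OF step_dom, of x' x] by simp
  also have "\<dots> = ?r \<bullet> (?y - ?y') - 1 / \<gamma> * ((?y - ?y') \<bullet> D (?y - ?y'))"
  proof -
    define e where "e = ?y - ?y'"
    have e: "?y' - ?y = - e" "D (?y' - x') - D (?y - x) = D (x - x') - D e"
      by (simp_all add: e_def D_simps)
    have "(grad f x + (1 / \<gamma>) *\<^sub>R D (?y - x)) \<bullet> (- e) + (grad f x' + (1 / \<gamma>) *\<^sub>R D (?y' - x')) \<bullet> e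
      = (grad f x' - grad f x + (1 / \<gamma>) *\<^sub>R (D (?y' - x') - D (?y - x))) \<bullet> e"
      by (simp add: inner_add_left inner_diff_left right_diff_distrib)
    also have "\<dots> = ?r \<bullet> e - 1 / \<gamma> * (e \<bullet> D e)"
      unfolding e(2) by (simp add: inner_add_left inner_diff_left scaleR_diff_right D_sym)
    finally show ?thesis unfolding e(1) e_def by simp
  qed
  finally have "1 / \<gamma> * ((?y - ?y') \<bullet> D (?y - ?y')) \<le> ?r \<bullet> (?y - ?y')" by simp
  moreover have "1 / \<gamma> * (\<eta> * (norm (?y - ?y'))\<^sup>2) \<le> 1 / \<gamma> * ((?y - ?y') \<bullet> D (?y - ?y'))"
    using gamma_pos by (intro mult_left_mono D_coercive) auto
  moreover have "?r \<bullet> (?y - ?y') \<le> norm ?r * norm (?y - ?y')" by (rule norm_cauchy_schwarz)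
  ultimately have "(\<eta> / \<gamma> * norm (?y - ?y')) * norm (?y - ?y') \<le> norm ?r * norm (?y - ?y')"
    by (simp add: power2_eq_square)
  then have "\<eta> / \<gamma> * norm (?y - ?y') \<le> norm ?r"
    by (cases "?y = ?y'") (simp_all add: mult_right_le_imp_le)
  then show ?thesis using eta_pos gamma_pos by (simp add: field_simps)
qed

lemma isCont_step:
  assumes "x \<in> S" shows "isCont step x"
proof -
  have "((\<lambda>z. \<gamma> / \<eta> * norm (grad f x - grad f z + (1 / \<gamma>) *\<^sub>R D (z - x))) \<longlongrightarrow>
      \<gamma> / \<eta> * norm (grad f x - grad f x + (1 / \<gamma>) *\<^sub>R D (x - x))) (at x)"
    using isCont_grad_f[OF assms] unfolding isCont_def
    by (intro tendsto_intros bounded_linear.tendsto[OF bounded_linear_D])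
  then have "((\<lambda>z. \<gamma> / \<eta> * norm (grad f x - grad f z + (1 / \<gamma>) *\<^sub>R D (z - x))) \<longlongrightarrow> 0) (at x)"
    using linear_0[OF linear_D] by simp
  then have "((\<lambda>z. step z - step x) \<longlongrightarrow> 0) (at x)"
    by (rule Lim_null_comparison[rotated]) (intro always_eventually allI norm_step_diff_le)
  then show ?thesis by (simp add: isCont_def LIM_zero_iff)
qed

section \<open>Subgradients at base points and at forward-backward steps\<close>

text \<open>Let \<open>H\<close> be the derivative of \<open>grad f\<close> at \<open>x0\<close>. The subgradient is the derivative at \<open>x0\<close> of
  \<open>x \<mapsto> G(x, y)\<close> for the fixed \<open>y = P x0\<close>, namely \<open>(H\<^sup>* - D/\<gamma>) (P x0 - x0)\<close>. For the lower estimate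
  the roles are exchanged: the value at \<open>x\<close> is attained at \<open>P x\<close>, which is only a candidate at
  \<open>x0\<close>, so the increment of the envelope is at least that of \<open>z \<mapsto> G(z, P x)\<close>. Continuity
  of \<open>P\<close> makes the error of replacing \<open>P x\<close> by \<open>P x0\<close> of order \<open>o(|x - x0|)\<close>.\<close>

lemma regular_subdiff_envelope_nonempty:
  assumes x0: "x0 \<in> closure (edom g)"
  shows "regular_subdiff (fb_envelope f g \<gamma> D) x0 \<noteq> {}"
proof -
  have x0S: "x0 \<in> S" using x0 dom_S by blast
  obtain H where H: "(grad f has_derivative H) (at x0)" using grad_f_differentiable[OF x0S] .
  have blH: "bounded_linear H" using H by (rule has_derivative_bounded_linear)
  obtain KH where KH: "\<And>u. norm (H u) \<le> norm u * KH" using bounded_linear.bounded[OF blH] by blast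
  obtain KD where KD: "\<And>u. norm (D u) \<le> norm u * KD" using bounded_linear.bounded[OF bounded_linear_D] by blast
  define w0 where "w0 = step x0 - x0"
  define v where "v = adjoint H w0 - (1 / \<gamma>) *\<^sub>R D w0"
  define R1 where "R1 = (\<lambda>x. fr x - fr x0 - (x - x0) \<bullet> grad f x0)"
  define R2 where "R2 = (\<lambda>x. grad f x - grad f x0 - H (x - x0))"
  define p where "p = (\<lambda>x. step x - x - w0)"
  define B where "B = (\<lambda>x. norm (R1 x) / norm (x - x0) + norm (R2 x) / norm (x - x0) * norm (step x - x)
     + KH * norm (p x) + KD * (2 * norm (p x) + norm (x - x0)) / (2 * \<gamma>))"
  have v_inner: "v \<bullet> u = H u \<bullet> w0 - 1 / \<gamma> * (D u \<bullet> w0)" for u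
  proof -
    have "adjoint H w0 \<bullet> u = H u \<bullet> w0"
      using adjoint_works[OF bounded_linear.linear[OF blH], of u w0] by (simp add: inner_commute)
    moreover have "D w0 \<bullet> u = D u \<bullet> w0" by (metis D_sym inner_commute)
    ultimately show ?thesis by (simp add: v_def inner_diff_left)
  qed
  \<comment> \<open>\<open>R1\<close>, \<open>R2\<close> are the Taylor remainders of \<open>f\<close> and \<open>grad f\<close>, and \<open>p\<close> is the drift of \<open>step x - x\<close>;
    \<open>B\<close> collects their relative sizes.\<close>
  have lower: "env x0 + v \<bullet> (x - x0) - B x * norm (x - x0) \<le> env x" if "x \<noteq> x0" for x
  proof -
    define u where "u = x - x0"
    define w where "w = step x - x"
    have u: "norm u > 0" using that by (simp add: u_def)
    have "env x0 \<le> gr (step x) + smooth_model x0 (step x) + fr x0" by (rule env_le[OF step_dom])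
    then have "(smooth_model x (step x) + fr x) - (smooth_model x0 (step x) + fr x0) \<le> env x - env x0"
      by (simp add: env_def)
    moreover have "(smooth_model x (step x) + fr x) - (smooth_model x0 (step x) + fr x0) - v \<bullet> u =
        R1 x + R2 x \<bullet> w + H u \<bullet> p x - 1 / (2 * \<gamma>) * (D u \<bullet> (2 *\<^sub>R p x + u))"
    proof -
      have gx: "grad f x = R2 x + grad f x0 + H u" by (simp add: R2_def u_def)
      have fx: "fr x = R1 x + fr x0 + u \<bullet> grad f x0" by (simp add: R1_def u_def)
      have yx: "step x - x0 = w + u" "step x - x = w" by (simp_all add: w_def u_def)
      have px: "p x = w - w0" by (simp add: p_def w_def)
      have quad: "(w + u) \<bullet> D (w + u) = w \<bullet> D w + 2 * (D u \<bullet> w) + D u \<bullet> u"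
        by (simp add: D_simps inner_add_left inner_add_right D_sym) (metis D_sym inner_commute)
      have "1 / (2 * \<gamma>) * (A - (A + 2 * P + E)) + 1 / \<gamma> * P0
          = - (1 / (2 * \<gamma>) * (2 * (P - P0) + E))" for A P E P0
        using gamma_pos by (simp add: field_simps)
      from this[of "w \<bullet> D w" "D u \<bullet> w" "D u \<bullet> u" "D u \<bullet> w0"] show ?thesis
        unfolding smooth_model_def v_inner yx gx fx px quad
        by (simp add: inner_add_left inner_add_right inner_diff_left inner_diff_right inner_commute algebra_simps)
    qed
    moreover have "- (norm (R1 x)) \<le> R1 x" by simp
    moreover have "- (norm (R2 x) * norm w) \<le> R2 x \<bullet> w"
      using Cauchy_Schwarz_ineq2[of "R2 x" w] by linarith
    moreover have "- (norm u * KH * norm (p x)) \<le> H u \<bullet> p x"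
      using Cauchy_Schwarz_ineq2[of "H u" "p x"] mult_right_mono[OF KH[of u], of "norm (p x)"] by simp
    moreover have "1 / (2 * \<gamma>) * (D u \<bullet> (2 *\<^sub>R p x + u)) \<le> 1 / (2 * \<gamma>) * (norm u * KD * (2 * norm (p x) + norm u))"
    proof (rule mult_left_mono)
      have "D u \<bullet> (2 *\<^sub>R p x + u) \<le> norm (D u) * norm (2 *\<^sub>R p x + u)" by (rule norm_cauchy_schwarz)
      also have "\<dots> \<le> (norm u * KD) * (2 * norm (p x) + norm u)"
        using norm_triangle_ineq[of "2 *\<^sub>R p x" u] KD[of u]
        by (intro mult_mono) (auto intro: order_trans[OF norm_ge_zero])
      finally show "D u \<bullet> (2 *\<^sub>R p x + u) \<le> norm u * KD * (2 * norm (p x) + norm u)" .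
    qed (use gamma_pos in simp)
    moreover have "B x * norm u = norm (R1 x) + norm (R2 x) * norm w + norm u * KH * norm (p x)
        + 1 / (2 * \<gamma>) * (norm u * KD * (2 * norm (p x) + norm u))"
      using u by (simp add: B_def u_def[symmetric] w_def[symmetric] field_simps)
    ultimately show ?thesis unfolding u_def[symmetric] by linarith
  qed
  have p0: "(p \<longlongrightarrow> 0) (at x0)"
  proof -
    have "(p \<longlongrightarrow> step x0 - x0 - w0) (at x0)"
      unfolding p_def using isCont_step[OF x0S] unfolding isCont_def by (intro tendsto_intros)
    then show ?thesis by (simp add: w0_def)
  qed
  have "(B \<longlongrightarrow> 0 + 0 * norm (step x0 - x0) + KH * norm (0::'a) + KD * (2 * norm (0::'a) + norm (x0 - x0)) / (2 * \<gamma>)) (at x0)"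
  proof -
    have "((\<lambda>x. norm (R1 x) / norm (x - x0)) \<longlongrightarrow> 0) (at x0)"
      using f_gderiv[OF x0S] unfolding gderiv_def has_derivative_iff_norm R1_def by simp
    moreover have "((\<lambda>x. norm (R2 x) / norm (x - x0)) \<longlongrightarrow> 0) (at x0)"
      using H unfolding has_derivative_iff_norm R2_def by simp
    moreover note isCont_step[OF x0S, unfolded isCont_def] p0
    ultimately show ?thesis unfolding B_def using gamma_pos by (intro tendsto_intros) auto
  qed
  then have B0: "(B \<longlongrightarrow> 0) (at x0)" by simp
  have "v \<in> regular_subdiff (fb_envelope f g \<gamma> D) x0"
    unfolding regular_subdiff_iff
  proof (intro conjI allI impI)
    fix e :: real assume "e > 0"
    with B0 have "\<forall>\<^sub>F x in at x0. B x < e" by (rule order_tendstoD)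
    moreover have "\<forall>\<^sub>F x in at x0. x \<noteq> x0" by (simp add: eventually_at_filter)
    ultimately show "\<forall>\<^sub>F x in at x0. fb_envelope f g \<gamma> D x0
        + ereal (v \<bullet> (x - x0) - e * norm (x - x0)) \<le> fb_envelope f g \<gamma> D x"
    proof eventually_elim
      case (elim x)
      have "B x * norm (x - x0) \<le> e * norm (x - x0)" using elim(1) by (intro mult_right_mono) auto
      then have "env x0 + (v \<bullet> (x - x0) - e * norm (x - x0)) \<le> env x" using lower[OF elim(2)] by linarith
      then show ?case
        by (cases "x \<in> closure (edom g)") (simp_all add: envelope_eq_env x0 envelope_outside)
    qed
  qed (simp add: envelope_eq_env x0)
  then show ?thesis by blast
qed

text \<open>The first-order condition provides a subgradient of \<open>g\<close> at \<open>P x\<close>; adding \<open>grad f\<close> at \<open>P x\<close>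
  gives one of \<open>f + g\<close>. It is small when the step is short, which is how the KL inequality of \<open>f + g\<close>
  becomes useful.\<close>

lemma step_residual_subgradient:
  assumes "step x \<in> S"
  shows "grad f (step x) - grad f x - (1 / \<gamma>) *\<^sub>R D (step x - x)
    \<in> regular_subdiff (\<lambda>x. f x + g x) (step x)"
proof -
  define y where "y = step x"
  define w where "w = grad f y - grad f x - (1 / \<gamma>) *\<^sub>R D (y - x)"
  have y: "y \<in> S" "y \<in> edom g" using assms step_dom by (simp_all add: y_def)
  obtain a where a: "f y = ereal a" using f_finite[OF y(1)] by blast
  obtain b where b: "g y = ereal b" using y(2) by (rule g_realE)
  have "w \<in> regular_subdiff (\<lambda>x. f x + g x) y"
    unfolding regular_subdiff_iff
  proof (intro conjI allI impI)
    fix e :: real assume "e > 0"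
    have "((\<lambda>z. norm (fr z - fr y - (z - y) \<bullet> grad f y) / norm (z - y)) \<longlongrightarrow> 0) (at y)"
      using f_gderiv[OF y(1)] unfolding gderiv_def has_derivative_iff_norm by simp
    then have "\<forall>\<^sub>F z in at y. norm (fr z - fr y - (z - y) \<bullet> grad f y) / norm (z - y) < e"
      using \<open>e > 0\<close> by (rule order_tendstoD)
    moreover have "\<forall>\<^sub>F z in at y. z \<in> S"
      using open_S y(1) by (rule eventually_at_in_open')
    moreover have "\<forall>\<^sub>F z in at y. z \<noteq> y" by (simp add: eventually_at_filter)
    ultimately show "\<forall>\<^sub>F z in at y. f y + g y + ereal (w \<bullet> (z - y) - e * norm (z - y)) \<le> f z + g z"
    proof eventually_elim
      case (elim z)
      obtain c where c: "f z = ereal c" using f_finite[OF elim(2)] by blast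
      show ?case
      proof (cases "z \<in> edom g")
        case True
        then obtain k where k: "g z = ereal k" by (rule g_realE)
        have "norm (c - a - (z - y) \<bullet> grad f y) < e * norm (z - y)"
          using elim(1,3) by (simp add: a c pos_divide_less_eq)
        then have "a + grad f y \<bullet> (z - y) - e * norm (z - y) \<le> c"
          by (simp add: inner_commute)
        moreover have "b - k \<le> (grad f x + (1 / \<gamma>) *\<^sub>R D (y - x)) \<bullet> (z - y)"
          using step_optimality[OF True, of x] by (simp add: y_def[symmetric] b k)
        ultimately show ?thesis
          by (simp add: a b c k w_def inner_diff_left inner_add_left)
      next
        case False
        then show ?thesis by (simp add: edom_def c)
      qed
    qed
  qed (simp add: a b)
  then show ?thesis by (simp add: w_def y_def)
qed

lemma regular_subdiff_envelope_dom:
  assumes "v \<in> regular_subdiff (fb_envelope f g \<gamma> D) x"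
  shows "x \<in> closure (edom g)"
proof (rule ccontr)
  assume "x \<notin> closure (edom g)"
  with assms show False by (simp add: regular_subdiff_def envelope_outside)
qed

lemma smooth_model_diagonal: "smooth_model x x = 0"
  by (simp add: smooth_model_def)

end

section \<open>Transfer of the KL inequality near the base point\<close>

lemma powr_sum_le:
  fixes s a b \<theta> :: real
  assumes "0 < s" "s \<le> a + b" "0 \<le> a" "0 \<le> b" "0 < \<theta>" "\<theta> \<le> 1"
  shows "s powr \<theta> \<le> 2 * (a powr \<theta> + b powr \<theta>)"
proof -
  have "s powr \<theta> \<le> (2 * max a b) powr \<theta>"
    using assms by (intro powr_mono2) auto
  also have "\<dots> = 2 powr \<theta> * max a b powr \<theta>"
    by (rule powr_mult)
  also have "\<dots> \<le> 2 * (a powr \<theta> + b powr \<theta>)"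
    using assms powr_mono[of \<theta> 1 2] by (intro mult_mono) (auto simp: max_def)
  finally show ?thesis .
qed

text \<open>Near the base point \<open>x0\<close> the Lipschitz modulus enters only through a Lipschitz constant \<open>l\<close> of
  \<open>grad f\<close> on a ball.\<close>

locale forward_backward_near = forward_backward +
  fixes x0 :: 'a and \<epsilon> l :: real
  assumes x0: "x0 \<in> closure (edom g)" and eps: "\<epsilon> > 0" "cball x0 \<epsilon> \<subseteq> S"
    and l_nonneg: "l \<ge> 0" and small_step: "\<gamma> * l < \<eta>"
    and lipschitz: "\<And>z w. z \<in> cball x0 \<epsilon> \<Longrightarrow> w \<in> cball x0 \<epsilon> \<Longrightarrow> norm (grad f z - grad f w) \<le> l * norm (z - w)"
begin

lemma f_upper:
  assumes "x \<in> cball x0 \<epsilon>" "y \<in> cball x0 \<epsilon>"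
  shows "fr y \<le> fr x + grad f x \<bullet> (y - x) + l / 2 * (norm (y - x))\<^sup>2"
  by (rule descent_lemma[OF convex_cball assms]) (use eps f_gderiv lipschitz in blast)+

lemma f_lower:
  assumes "x \<in> cball x0 \<epsilon>" "y \<in> cball x0 \<epsilon>"
  shows "fr x + grad f x \<bullet> (y - x) - l / 2 * (norm (y - x))\<^sup>2 \<le> fr y"
proof -
  have "- fr y \<le> - fr x + (- grad f x) \<bullet> (y - x) + l / 2 * (norm (y - x))\<^sup>2"
  proof (rule descent_lemma[OF convex_cball assms])
    show "GDERIV (\<lambda>y. - fr y) z :> - grad f z" if "z \<in> cball x0 \<epsilon>" for z
      using f_gderiv eps that by (intro GDERIV_minus) blast
    show "norm (- grad f z - - grad f w) \<le> l * norm (z - w)" if "z \<in> cball x0 \<epsilon>" "w \<in> cball x0 \<epsilon>" for z w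
      using lipschitz[OF that] by (simp add: norm_minus_commute)
  qed
  then show ?thesis by simp
qed

lemma margin_pos: "\<eta> / \<gamma> - l > 0"
  using small_step gamma_pos by (simp add: field_simps)

text \<open>The target point \<open>x + d\<close> stays fixed while the base point moves towards it. The upper descent
  estimate for \<open>f\<close> and the Lipschitz bound for \<open>grad f\<close> cost \<open>l t\<^sup>2/2 + (1 - t) l t = l t (1 - t/2)\<close>
  times \<open>|d|\<^sup>2\<close>; the shrinking quadratic term gains the same factor \<open>t (1 - t/2)\<close> times at
  least \<open>(\<eta>/\<gamma>) |d|\<^sup>2\<close>.\<close>

lemma model_along_step:
  assumes x: "x \<in> cball x0 \<epsilon>" "x + t *\<^sub>R d \<in> cball x0 \<epsilon>" and t: "0 \<le> t" "t \<le> 1"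
  shows "smooth_model (x + t *\<^sub>R d) (x + d) + fr (x + t *\<^sub>R d)
    \<le> smooth_model x (x + d) + fr x - t * (1 - t / 2) * ((\<eta> / \<gamma> - l) * (norm d)\<^sup>2)"
proof -
  let ?z = "x + t *\<^sub>R d"
  have z: "x + d - ?z = (1 - t) *\<^sub>R d" "x + d - x = d" by (simp_all add: algebra_simps)
  have Qz: "smooth_model ?z (x + d) = (1 - t) * (grad f ?z \<bullet> d) + (1 - t)\<^sup>2 * (1 / (2 * \<gamma>) * (d \<bullet> D d))"
    unfolding smooth_model_def z by (simp add: D_simps power2_eq_square)
  have Qx: "smooth_model x (x + d) = grad f x \<bullet> d + 1 / (2 * \<gamma>) * (d \<bullet> D d)"
    unfolding smooth_model_def z by simp
  have up: "fr ?z \<le> fr x + t * (grad f x \<bullet> d) + l / 2 * t\<^sup>2 * (norm d)\<^sup>2"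
    using f_upper[OF x] by (simp add: power_mult_distrib mult_ac)
  have slope: "(1 - t) * (grad f ?z \<bullet> d - grad f x \<bullet> d) \<le> (1 - t) * (l * t * (norm d)\<^sup>2)"
  proof (rule mult_left_mono)
    have "(grad f ?z - grad f x) \<bullet> d \<le> norm (grad f ?z - grad f x) * norm d" by (rule norm_cauchy_schwarz)
    also have "\<dots> \<le> (l * norm (?z - x)) * norm d" using lipschitz[OF x(2,1)] by (rule mult_right_mono) simp
    finally show "grad f ?z \<bullet> d - grad f x \<bullet> d \<le> l * t * (norm d)\<^sup>2"
      using t by (simp add: inner_diff_left power2_eq_square mult_ac)
  qed (use t in simp)
  have quad: "t * (1 - t / 2) * (\<eta> / \<gamma> * (norm d)\<^sup>2) \<le> t * (1 - t / 2) * (2 * (1 / (2 * \<gamma>) * (d \<bullet> D d)))"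
    using t gamma_pos divide_right_mono[OF D_coercive[of d], of \<gamma>] by (intro mult_left_mono) auto
  have "(1 - t) * b + (1 - t)\<^sup>2 * h + F' \<le> a + h + F - t * (1 - t / 2) * ((\<kappa> - l) * N)"
    if "F' \<le> F + t * a + l / 2 * t\<^sup>2 * N" "(1 - t) * (b - a) \<le> (1 - t) * (l * t * N)"
      "t * (1 - t / 2) * (\<kappa> * N) \<le> t * (1 - t / 2) * (2 * h)" for a b h F F' \<kappa> N
    using that by (simp add: algebra_simps power2_eq_square) (simp add: diff_divide_distrib)
  from this[OF up slope quad] show ?thesis unfolding Qz Qx .
qed

text \<open>Test \<open>v\<close> in the direction \<open>d = step x - x\<close>. On the short segment from \<open>x\<close> in this direction the
  envelope falls by at least \<open>t (1 - t/2) (\<eta>/\<gamma> - l) |d|\<^sup>2\<close>, and \<open>1 - t/2 \<ge> 1/2\<close>. Here \<open>step x\<close> may lie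
  outside the ball; only the start of the segment has to be inside.\<close>

lemma step_length_le_subgradient:
  assumes x: "x \<in> ball x0 \<epsilon>" "x \<in> closure (edom g)"
    and v: "v \<in> regular_subdiff (fb_envelope f g \<gamma> D) x"
  shows "(\<eta> / \<gamma> - l) / 2 * norm (step x - x) \<le> norm v"
proof -
  define d where "d = step x - x"
  define \<mu> where "\<mu> = \<eta> / \<gamma> - l"
  have \<mu>: "\<mu> > 0" using margin_pos by (simp add: \<mu>_def)
  show ?thesis
  proof (cases "d = 0")
    case False
    have "\<mu> / 2 * norm d \<le> norm v + e" if e: "e > 0" for e
    proof -
      have "\<forall>\<^sub>F z in at x. fb_envelope f g \<gamma> D x + ereal (v \<bullet> (z - x) - e * norm (z - x)) \<le> fb_envelope f g \<gamma> D z"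
        using v e unfolding regular_subdiff_iff by blast
      moreover have lim: "((\<lambda>t. x + t *\<^sub>R d) \<longlongrightarrow> x + 0 *\<^sub>R d) (at_right 0)"
        by (intro tendsto_intros)
      then have "filterlim (\<lambda>t. x + t *\<^sub>R d) (at x) (at_right 0)"
        using False by (auto simp: filterlim_at eventually_at_right_field intro!: exI[of _ 1])
      ultimately have "\<forall>\<^sub>F t in at_right 0. fb_envelope f g \<gamma> D x + ereal (v \<bullet> (x + t *\<^sub>R d - x)
          - e * norm (x + t *\<^sub>R d - x)) \<le> fb_envelope f g \<gamma> D (x + t *\<^sub>R d)"
        unfolding filterlim_iff by blast
      moreover have "\<forall>\<^sub>F t in at_right 0. x + t *\<^sub>R d \<in> ball x0 \<epsilon>"
        using x(1) by (intro topological_tendstoD[OF lim]) auto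
      moreover have "\<forall>\<^sub>F t in at_right 0. 0 < t \<and> t < (1::real)"
        by (auto simp: eventually_at_right_field intro!: exI[of _ 1])
      ultimately have "\<forall>\<^sub>F t in at_right 0.
          fb_envelope f g \<gamma> D x + ereal (v \<bullet> (x + t *\<^sub>R d - x) - e * norm (x + t *\<^sub>R d - x))
            \<le> fb_envelope f g \<gamma> D (x + t *\<^sub>R d)
          \<and> x + t *\<^sub>R d \<in> ball x0 \<epsilon> \<and> 0 < t \<and> t < 1"
        by eventually_elim blast
      then show ?thesis
      proof (rule eventually_happens'[OF trivial_limit_at_right_real, elim_format], elim exE conjE)
        fix t :: real
        let ?z = "x + t *\<^sub>R d"
        assume sub: "fb_envelope f g \<gamma> D x + ereal (v \<bullet> (?z - x) - e * norm (?z - x)) \<le> fb_envelope f g \<gamma> D ?z"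
          and z_ball: "?z \<in> ball x0 \<epsilon>" and t: "0 < t" "t < 1"
        have "?z = (1 - t) *\<^sub>R x + t *\<^sub>R step x" by (simp add: d_def algebra_simps)
        then have z: "?z \<in> closure (edom g)"
          using convex_closure[OF convex_dom] x(2) step_dom[of x] closure_subset[of "edom g"] t
          by (auto simp: convex_alt)
        have "env x + (v \<bullet> (t *\<^sub>R d) - e * norm (t *\<^sub>R d)) \<le> env ?z"
          using sub by (simp add: envelope_eq_env x(2) z)
        also have "env ?z \<le> gr (step x) + smooth_model ?z (step x) + fr ?z" by (rule env_le[OF step_dom])
        also have "step x = x + d" by (simp add: d_def)
        also have "gr (x + d) + smooth_model ?z (x + d) + fr ?z \<le> gr (x + d) + smooth_model x (x + d) + fr x
            - t * (1 - t / 2) * (\<mu> * (norm d)\<^sup>2)"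
          using model_along_step[of x t d] x(1) z_ball t by (simp add: \<mu>_def less_imp_le)
        also have "gr (x + d) + smooth_model x (x + d) + fr x = env x" by (simp add: env_def d_def)
        finally have "t * ((1 - t / 2) * (\<mu> * (norm d)\<^sup>2)) \<le> t * (e * norm d - v \<bullet> d)"
          using t by (simp add: algebra_simps)
        then have "(1 - t / 2) * (\<mu> * (norm d)\<^sup>2) \<le> e * norm d - v \<bullet> d"
          using t(1) by (rule mult_left_le_imp_le)
        moreover have "1 / 2 * (\<mu> * (norm d)\<^sup>2) \<le> (1 - t / 2) * (\<mu> * (norm d)\<^sup>2)"
          using t \<mu> by (intro mult_right_mono) auto
        moreover have "- (v \<bullet> d) \<le> norm v * norm d"
          using Cauchy_Schwarz_ineq2[of v d] by linarith
        ultimately have "(\<mu> / 2 * norm d) * norm d \<le> (norm v + e) * norm d"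
          by (simp add: algebra_simps power2_eq_square)
        then show ?thesis using False by (simp add: mult_right_le_imp_le)
      qed
    qed
    then show ?thesis unfolding d_def[symmetric] \<mu>_def[symmetric] by (rule field_le_epsilon)
  qed (simp add: d_def)
qed

text \<open>The step satisfies the descent condition \<open>l \<le> \<eta>/\<gamma>\<close>, so the model majorizes \<open>f + g\<close> at
  \<open>step x\<close>. This keeps \<open>step x\<close> inside the value window of the KL inequality.\<close>

lemma step_value_le_env:
  assumes "x \<in> cball x0 \<epsilon>" "step x \<in> cball x0 \<epsilon>"
  shows "fr (step x) + gr (step x) \<le> env x"
proof -
  let ?d = "step x - x"
  have "l / 2 * (norm ?d)\<^sup>2 \<le> \<eta> / (2 * \<gamma>) * (norm ?d)\<^sup>2"
    using margin_pos by (intro mult_right_mono) auto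
  also have "\<dots> \<le> 1 / (2 * \<gamma>) * (?d \<bullet> D ?d)"
    using D_coercive[of ?d] gamma_pos mult_left_mono[of "\<eta> * (norm ?d)\<^sup>2" _ "1 / (2 * \<gamma>)"] by simp
  finally show ?thesis using f_upper[OF assms] by (simp add: env_def smooth_model_def)
qed

lemma env_le_step_value:
  assumes "x \<in> cball x0 \<epsilon>" "step x \<in> cball x0 \<epsilon>" and K: "\<And>u. norm (D u) \<le> norm u * K"
  shows "env x \<le> fr (step x) + gr (step x) + (l / 2 + K / (2 * \<gamma>)) * (norm (step x - x))\<^sup>2"
proof -
  let ?d = "step x - x"
  have "?d \<bullet> D ?d \<le> norm ?d * norm (D ?d)" by (rule norm_cauchy_schwarz)
  also have "\<dots> \<le> norm ?d * (norm ?d * K)" by (intro mult_left_mono K) auto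
  finally have "1 / (2 * \<gamma>) * (?d \<bullet> D ?d) \<le> 1 / (2 * \<gamma>) * (K * (norm ?d)\<^sup>2)"
    using gamma_pos by (intro mult_left_mono) (auto simp: power2_eq_square mult_ac)
  then show ?thesis using f_lower[OF assms(1,2)] by (simp add: env_def smooth_model_def algebra_simps)
qed

text \<open>For \<open>x\<close> near \<open>x0\<close> the point \<open>y = step x\<close> is near \<open>x0\<close> too, and the KL inequality of
  \<open>f + g\<close> at \<open>y\<close> applies to the subgradient of \<open>step_residual_subgradient\<close>. The value excess \<open>a\<close> at \<open>y\<close>
  may be nonpositive; then the quadratic gap alone bounds the excess of the envelope.\<close>

lemma KL_exponent_at_fixed_point:
  assumes fixed: "step x0 = x0" and KL: "KL_exponent (\<lambda>x. f x + g x) \<theta> x0"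
    and \<theta>: "1 / 2 \<le> \<theta>" "\<theta> < 1"
  shows "KL_exponent (fb_envelope f g \<gamma> D) \<theta> x0"
proof -
  let ?E = "fb_envelope f g \<gamma> D"
  let ?F = "\<lambda>x. f x + g x"
  define \<mu> where "\<mu> = (\<eta> / \<gamma> - l) / 2"
  have \<mu>: "\<mu> > 0" using margin_pos by (simp add: \<mu>_def)
  obtain KD where KD: "KD > 0" "\<And>u. norm (D u) \<le> norm u * KD"
    using bounded_linear.pos_bounded[OF bounded_linear_D] by blast
  define B where "B = l / 2 + KD / (2 * \<gamma>)"
  define W where "W = l + KD / \<gamma>"
  have BW: "B > 0" "W > 0" using KD(1) l_nonneg gamma_pos by (auto simp: B_def W_def add_nonneg_pos)
  obtain \<delta> K :: real and \<omega> :: ereal where \<delta>: "\<delta> > 0" and \<omega>: "\<omega> > 0" and K: "K > 0"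
    and KL': "\<And>x v. x \<in> cball x0 \<delta> \<Longrightarrow> v \<in> limiting_subdiff ?F x \<Longrightarrow> ?F x0 < ?F x \<Longrightarrow> ?F x < ?F x0 + \<omega> \<Longrightarrow>
       real_of_ereal (?F x - ?F x0) powr \<theta> \<le> K * norm v"
    by (rule KL_exponentD[OF KL]) (rule that)
  \<comment> \<open>The bound \<open>1 / 2\<close> ensures that \<open>x\<close> and \<open>step x\<close> are at distance at most 1.\<close>
  define \<rho> where "\<rho> = min (min \<epsilon> \<delta>) (1 / 2)"
  have \<rho>: "\<rho> > 0" "\<rho> \<le> \<epsilon>" "\<rho> \<le> \<delta>" "\<rho> \<le> 1 / 2" using eps \<delta> by (auto simp: \<rho>_def)
  have x0S: "x0 \<in> S" using x0 dom_S by blast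
  obtain d where d: "d > 0" "\<And>x. dist x x0 < d \<Longrightarrow> dist (step x) x0 < \<rho>"
    using isCont_step[OF x0S] \<rho>(1) fixed unfolding continuous_at_eps_delta by metis
  define \<delta>' where "\<delta>' = min d \<rho>"
  have F_real: "?F z = ereal (fr z + gr z)" if z: "z \<in> edom g" for z
  proof -
    have "z \<in> S" using z closure_subset dom_S by blast
    from f_finite[OF this] obtain a where "f z = ereal a" by blast
    moreover obtain b where "g z = ereal b" using z by (rule g_realE)
    ultimately show ?thesis by simp
  qed
  have dom_x0: "x0 \<in> edom g" using step_dom[of x0] fixed by simp
  have env_x0: "env x0 = fr x0 + gr x0" by (simp add: env_def fixed smooth_model_diagonal)
  show ?thesis
  proof (rule KL_exponentI[OF proper_envelope, where \<delta> = \<delta>' and \<omega> = \<omega> and K = "2 * (K * W + B powr \<theta>) / \<mu>"])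
    show "limiting_subdiff ?E x0 \<noteq> {}"
      using regular_subdiff_envelope_nonempty[OF x0] regular_subset_limiting[of ?E x0] by blast
    show "2 * (K * W + B powr \<theta>) / \<mu> > 0"
      using K BW \<mu> by (simp add: add_pos_pos)
    show "\<delta>' > 0" using d \<rho> by (simp add: \<delta>'_def)
    fix x v assume x: "x \<in> ball x0 \<delta>'" and v: "v \<in> regular_subdiff ?E x"
      and gt: "?E x0 < ?E x" and lt: "?E x < ?E x0 + \<omega>"
    have x_dom: "x \<in> closure (edom g)"
      using v by (rule regular_subdiff_envelope_dom)
    define y where "y = step x"
    define r where "r = norm (y - x)"
    have near: "x \<in> ball x0 \<epsilon>" "x \<in> cball x0 \<epsilon>" "step x \<in> cball x0 \<epsilon>" "y \<in> cball x0 \<delta>" "dist x x0 < 1 / 2" "dist y x0 < 1 / 2"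
      using x \<rho> d(2)[of x] by (auto simp: \<delta>'_def y_def dist_commute)
    have r1: "0 \<le> r" "r \<le> 1"
      using near(5,6) dist_triangle2[of y x x0] by (simp_all add: r_def dist_norm)
    have r_v: "\<mu> * r \<le> norm v"
      using step_length_le_subgradient[OF near(1) x_dom v] by (simp add: \<mu>_def r_def y_def)
    have dom_y: "y \<in> edom g" by (simp add: y_def step_dom)
    define s where "s = env x - env x0"
    have s: "s > 0" and s_eq: "real_of_ereal (?E x - ?E x0) = s"
      using gt by (simp_all add: envelope_eq_env x_dom x0 s_def)
    define a where "a = (fr y + gr y) - (fr x0 + gr x0)"
    have y_le: "fr y + gr y \<le> env x"
      unfolding y_def by (rule step_value_le_env[OF near(2,3)])
    have s_le: "s \<le> a + B * r\<^sup>2"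
      using env_le_step_value[OF near(2,3) KD(2)] by (simp add: s_def a_def env_x0 B_def r_def y_def)
    have a_bound: "max a 0 powr \<theta> \<le> K * W * r"
    proof (cases "a > 0")
      case True
      define w where "w = grad f y - grad f x - (1 / \<gamma>) *\<^sub>R D (y - x)"
      have "w \<in> limiting_subdiff ?F y"
        unfolding w_def y_def
        by (rule subsetD[OF regular_subset_limiting step_residual_subgradient])
          (rule subsetD[OF eps(2) near(3)])
      moreover have "?F x0 < ?F y"
        using True by (simp add: F_real dom_x0 dom_y a_def)
      moreover have "?F y < ?F x0 + \<omega>"
      proof -
        have "?F y \<le> ?E x" using y_le by (simp add: F_real dom_y envelope_eq_env x_dom)
        also note lt
        also have "?E x0 = ?F x0" by (simp add: F_real dom_x0 envelope_eq_env x0 env_x0)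
        finally show ?thesis .
      qed
      ultimately have "real_of_ereal (?F y - ?F x0) powr \<theta> \<le> K * norm w"
        by (rule KL'[OF near(4)])
      also have "norm w \<le> W * r"
      proof -
        have "norm w \<le> norm (grad f y - grad f x) + norm ((1 / \<gamma>) *\<^sub>R D (y - x))"
          unfolding w_def by (rule norm_triangle_ineq4)
        moreover have "norm (grad f y - grad f x) \<le> l * r"
          using lipschitz[OF near(3,2)] by (simp add: y_def r_def)
        moreover have "norm ((1 / \<gamma>) *\<^sub>R D (y - x)) \<le> KD / \<gamma> * r"
          using KD(2)[of "y - x"] gamma_pos by (simp add: r_def divide_right_mono mult.commute)
        ultimately show ?thesis by (simp add: W_def distrib_right)
      qed
      finally show ?thesis
        using True K by (simp add: F_real dom_x0 dom_y a_def)
    qed (use K BW r1 in simp)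
    \<comment> \<open>Here \<open>\<theta> \<ge> 1/2\<close> and \<open>r \<le> 1\<close> enter: the quadratic gap is harmless since \<open>2 \<theta> \<ge> 1\<close>.\<close>
    have "(B * r\<^sup>2) powr \<theta> \<le> B powr \<theta> * r"
    proof (cases "r = 0")
      case False
      then have "(r\<^sup>2) powr \<theta> = r powr (2 * \<theta>)"
        using r1 by (simp add: powr_powr flip: powr_numeral)
      also have "\<dots> \<le> r powr 1"
        using r1 False \<theta> by (intro powr_mono') auto
      finally show ?thesis
        using r1 BW by (simp add: powr_mult mult_left_mono)
    qed (use \<theta> in simp)
    moreover have "s powr \<theta> \<le> 2 * (max a 0 powr \<theta> + (B * r\<^sup>2) powr \<theta>)"
      using s s_le BW \<theta> by (intro powr_sum_le) auto
    ultimately have "s powr \<theta> \<le> 2 * (K * W + B powr \<theta>) * r"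
      using a_bound by (simp add: algebra_simps)
    also have "\<dots> \<le> 2 * (K * W + B powr \<theta>) * (norm v / \<mu>)"
      using r_v \<mu> K BW by (intro mult_left_mono) (auto simp: field_simps)
    finally show "real_of_ereal (?E x - ?E x0) powr \<theta> \<le> 2 * (K * W + B powr \<theta>) / \<mu> * norm v"
      unfolding s_eq by simp
  qed (use \<theta> \<omega> in auto)
qed

text \<open>By continuity the step length stays bounded below near \<open>x0\<close>, and so do the norms of all
  subgradients, while \<open>s powr \<theta> \<le> 1\<close> in the value window of width 1.\<close>

lemma KL_exponent_off_fixed_points:
  assumes moving: "step x0 \<noteq> x0" and \<theta>: "0 \<le> \<theta>" "\<theta> < 1"
  shows "KL_exponent (fb_envelope f g \<gamma> D) \<theta> x0"
proof -
  let ?E = "fb_envelope f g \<gamma> D"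
  define \<mu> where "\<mu> = (\<eta> / \<gamma> - l) / 2"
  have \<mu>: "\<mu> > 0" using margin_pos by (simp add: \<mu>_def)
  define \<rho> where "\<rho> = norm (step x0 - x0) / 2"
  have \<rho>: "\<rho> > 0" using moving by (simp add: \<rho>_def)
  have x0S: "x0 \<in> S" using x0 dom_S by blast
  have "((\<lambda>x. norm (step x - x)) \<longlongrightarrow> norm (step x0 - x0)) (nhds x0)"
    using isCont_step[OF x0S] unfolding continuous_at tendsto_at_iff_tendsto_nhds
    by (intro tendsto_intros) (auto simp: filterlim_ident)
  then have "\<forall>\<^sub>F x in nhds x0. \<rho> < norm (step x - x)"
    using \<rho> by (intro order_tendstoD(1)) (auto simp: \<rho>_def)
  then obtain d where d: "d > 0" "\<And>x. dist x x0 < d \<Longrightarrow> \<rho> < norm (step x - x)"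
    unfolding eventually_nhds_metric by blast
  show ?thesis
  proof (rule KL_exponentI[OF proper_envelope \<theta>, where \<delta> = "min d \<epsilon>" and \<omega> = 1 and K = "1 / (\<mu> * \<rho>)"])
    show "limiting_subdiff ?E x0 \<noteq> {}"
      using regular_subdiff_envelope_nonempty[OF x0] regular_subset_limiting[of ?E x0] by blast
    show "min d \<epsilon> > 0" "(1::ereal) > 0" "1 / (\<mu> * \<rho>) > 0" using d eps \<mu> \<rho> by simp_all
    fix x v assume x: "x \<in> ball x0 (min d \<epsilon>)" and v: "v \<in> regular_subdiff ?E x"
      and gt: "?E x0 < ?E x" and lt: "?E x < ?E x0 + 1"
    have x_dom: "x \<in> closure (edom g)"
      using v by (rule regular_subdiff_envelope_dom)
    define s where "s = env x - env x0"
    have s: "0 < s" "s < 1" and s_eq: "real_of_ereal (?E x - ?E x0) = s"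
      using gt lt by (simp_all add: envelope_eq_env x_dom x0 s_def one_ereal_def)
    have "\<mu> * \<rho> \<le> \<mu> * norm (step x - x)"
      using d(2)[of x] x \<mu> by (intro mult_left_mono) (auto simp: dist_commute)
    also have "\<dots> \<le> norm v"
      using step_length_le_subgradient[OF _ x_dom v] x by (simp add: \<mu>_def)
    finally have "1 \<le> 1 / (\<mu> * \<rho>) * norm v" using \<mu> \<rho> by (simp add: field_simps)
    moreover have "s powr \<theta> \<le> 1" using s \<theta> powr_mono2[of \<theta> s 1] by simp
    ultimately show "real_of_ereal (?E x - ?E x0) powr \<theta> \<le> 1 / (\<mu> * \<rho>) * norm v"
      unfolding s_eq by linarith
  qed
qed

end

theorem proposition1:
  fixes f g :: "'a::euclidean_space \<Rightarrow> ereal"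
    and \<O> :: "'a set"
    and D :: "'a \<Rightarrow> 'a"
    and xbar :: 'a
    and \<epsilon> \<theta> \<eta> \<gamma> :: real
    and L lam_g :: ereal
  assumes proper_f: "proper_fun f"
    and proper_g: "proper_fun g"
    and lsc_g: "lsc_fun g"
    and convex_g: "convex_fun g"
    and cont_g: "continuous_on (edom g) g"
    and lsc_f: "lsc_fun f"
    and open_O: "open \<O>"
    and dom_O: "closure (edom g) \<subseteq> \<O>"
    and C2_f: "twice_cont_diff_on f \<O>"
    and inf_F: "(INF x. f x + g x) > -\<infinity>"
    and xbar: "xbar \<in> closure (edom g)"
    and eps: "\<epsilon> > 0" "cball xbar \<epsilon> \<subseteq> \<O>"
    and L: "L = (SUP x\<in>cball xbar \<epsilon>. lip_modulus (grad f) x)"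
    and prox_g: "prox_bounded g" "lam_g = prox_threshold g" "0 < lam_g"
    and theta: "1 / 2 \<le> \<theta>" "\<theta> < 1"
    and KL_F: "KL_exponent (\<lambda>x. f x + g x) \<theta> xbar"
    and eta: "\<eta> > 0"
    and D: "self_adjoint D" "psd_ge D (\<lambda>u. \<eta> *\<^sub>R u)"
    and gamma: "0 < \<gamma>" "ereal \<gamma> < min (ereal \<eta> * lam_g) (ereal \<eta> / L)"
  shows "KL_exponent (fb_envelope f g \<gamma> D) \<theta> xbar"
proof -
  have psd_eta: "ereal \<gamma> < ereal \<eta> * lam_g" and small: "ereal \<gamma> < ereal \<eta> / L"
    using gamma(2) by simp_all
  have "ereal (\<gamma> / \<eta>) < lam_g"
    using psd_eta prox_g(3) eta by (cases lam_g) (auto simp: field_simps)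
  then have prox: "\<exists>l\<in>prox_parameters g. \<gamma> / \<eta> < l"
    unfolding prox_g(2) prox_threshold_def by (auto simp: less_SUP_iff)
  interpret forward_backward f g \<O> D \<eta> \<gamma>
    by unfold_locales (fact proper_g lsc_g convex_g open_O dom_O C2_f D eta gamma(1) prox)+
  obtain H where H: "\<And>x. x \<in> \<O> \<Longrightarrow> (grad f has_derivative blinfun_apply (H x)) (at x)"
    using C2_f unfolding twice_cont_diff_on_def by blast
  have slope_le_L: "ereal (norm (H x u) / norm u) \<le> L" if "x \<in> cball xbar \<epsilon>" "u \<noteq> 0" for x u
  proof -
    have "ereal (norm (H x u) / norm u) \<le> lip_modulus (grad f) x"
      using that eps(2) by (intro norm_derivative_le_lip_modulus H) auto
    also have "\<dots> \<le> L" unfolding L using that(1) by (rule SUP_upper)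
    finally show ?thesis .
  qed
  obtain l where l: "L = ereal l" "l \<ge> 0"
  proof -
    obtain b :: 'a where "b \<in> Basis" using nonempty_Basis by blast
    then have "ereal (norm (H xbar b) / norm b) \<le> L"
      using eps(1) by (intro slope_le_L) auto
    \<comment> \<open>A nonzero direction shows that the supremum is nonnegative, and \<open>\<eta>/\<infinity> = 0\<close> rules out \<open>L = \<infinity>\<close>.\<close>
    then have "0 \<le> L" by (rule order_trans[rotated]) simp
    moreover have "L \<noteq> \<infinity>" using small gamma(1) by auto
    ultimately show thesis using that by (cases L) auto
  qed
  have small_step: "\<gamma> * l < \<eta>"
  proof (cases "l = 0")
    case False
    then have "\<gamma> < \<eta> / l" using small unfolding l(1) by simp
    then show ?thesis using False l(2) by (simp add: pos_less_divide_eq)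
  qed (simp add: eta)
  have "norm (grad f z - grad f w) \<le> l * norm (z - w)"
    if "z \<in> cball xbar \<epsilon>" "w \<in> cball xbar \<epsilon>" for z w
  proof (rule differentiable_bound[OF convex_cball _ _ that])
    fix x assume x: "x \<in> cball xbar \<epsilon>"
    show "(grad f has_derivative blinfun_apply (H x)) (at x within cball xbar \<epsilon>)"
      by (rule has_derivative_at_withinI, rule H, rule subsetD[OF eps(2) x])
    show "onorm (blinfun_apply (H x)) \<le> l"
    proof (rule onorm_bound[OF l(2)])
      fix u show "norm (H x u) \<le> l * norm u"
        using slope_le_L[OF x, of u] by (cases "u = 0") (simp_all add: l(1) pos_divide_le_eq)
    qed
  qed
  then interpret forward_backward_near f g \<O> D \<eta> \<gamma> xbar \<epsilon> l
    by (intro forward_backward_near.intro forward_backward_near_axioms.intro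
        forward_backward_axioms xbar eps l(2) small_step)
  show ?thesis
  proof (cases "step xbar = xbar")
    case True
    then show ?thesis using KL_F theta by (rule KL_exponent_at_fixed_point)
  next
    case False
    then show ?thesis using theta by (intro KL_exponent_off_fixed_points) simp_all
  qed
qed

end
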